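(* (Littlewood-Richardson rule.) Let $\lambda,\mu,\nu$ be partitions, and let the integers $c^\lambda_{\mu\nu}$ be the structure constants defined by $$U_\mu\cdot U_\nu=\sum_\lambda c^\lambda_{\mu\nu}\,U_\lambda$$ (sum over partitions $\lambda$). Then $c^\lambda_{\mu\nu}$ is equal to the number of semistandard tableaux $T$ of shape $\lambda/\mu$ and content $\nu$ such that, for every $r$, the content vector $c(T_{\ge r})$ is a partition, where $T_{\ge r}$ denotes the subtableau of $T$ formed by the entries in columns $r$ and higher. (If $\mu\not\subset\lambda$ there are no tableaux of shape $\lambda/\mu$ and $c^\lambda_{\mu\nu}=0$.)
   Context: An integer sequence (integer vector) is a sequence $\alpha=(\alpha_1,\alpha_2,\ldots)$ of integers with only finitely many nonzero terms. It is a composition if all $\alpha_i\ge 0$ and a partition if $\alpha_i\ge\alpha_{i+1}\ge 0$ for all $i$. Let $\mathbb{A}=\mathbb{Z}[u_1,u_2,\ldots]$ be the polynomial ring in countably many independent variables, with $u_0=1$ and $u_r=0$ for $r<0$. For an integer vector $\alpha$ put $u_\alpha=\prod_i u_{\alpha_i}$. For $i<j$ let $R_{ij}(\alpha)=(\alpha_1,\ldots,\alpha_i+1,\ldots,\alpha_j-1,\ldots)$; a raising operator $R$ is a monomial in the $R_{ij}$, and $R\,u_\alpha:=u_{R\alpha}$ (the operator acts on the index $\alpha$). The Schur polynomial of an integer vector $\alpha$ is $$U_\alpha:=\prod_{i<j}(1-R_{ij})\,u_\alpha\in\mathbb{A};$$ after formal expansion only finitely many summands are nonzero. The $U_\lambda$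 for $\lambda$ a partition form a $\mathbb{Z}$-basis of $\mathbb{A}$. Partitions are identified with Young diagrams; $\mu\subset\lambda$ means $\mu_i\le\lambda_i$ for all $i$, and then $\lambda/\mu$ is the skew diagram $\lambda\smallsetminus\mu$. A (semistandard) tableau $T$ on $\lambda/\mu$ is a filling of the boxes of $\lambda/\mu$ with positive integers, weakly increasing along each row from left to right and strictly increasing down each column. The content of $T$ (or of any subfilling) is $c(T)=(c_1,c_2,\ldots)$ where $c_i$ is the number of entries equal to $i$. Columns are numbered $1,2,\ldots$ from left to right in $\lambda$. *)

theory Defs
  imports "HOL-Library.Poly_Mapping" "HOL-Library.FuncSet"
begin

text \<open>
  Everything is indexed from 0: the value of an integer sequence at \<open>i\<close> is the mathematical
  \<open>\<alpha>\<^sub>i\<^sub>+\<^sub>1\<close>, and the variable with index \<open>k\<close> of the polynomial ring is \<open>u\<^sub>k\<^sub>+\<^sub>1\<close>.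
\<close>

type_synonym int_seq = "nat \<Rightarrow>\<^sub>0 int"

type_synonym poly_ring = "(nat \<Rightarrow>\<^sub>0 nat) \<Rightarrow>\<^sub>0 int"

definition is_partition :: "int_seq \<Rightarrow> bool" where
  "is_partition \<alpha> \<longleftrightarrow>
     (\<forall>i. Poly_Mapping.lookup \<alpha> i \<ge> Poly_Mapping.lookup \<alpha> (Suc i) \<and> Poly_Mapping.lookup \<alpha> (Suc i) \<ge> 0)"


subsection \<open>Schur polynomials\<close>

definition u :: "int \<Rightarrow> poly_ring" where
  "u r = (if r < 0 then 0 else if r = 0 then 1
          else Poly_Mapping.single (Poly_Mapping.single (nat r - 1) 1) 1)"

text \<open>Restricting the product to the support is harmless, as \<^term>\<open>u 0 = 1\<close>.\<close>

definition u_seq :: "int_seq \<Rightarrow> poly_ring" where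
  "u_seq \<alpha> = (\<Prod>i\<in>Poly_Mapping.keys \<alpha>. u (Poly_Mapping.lookup \<alpha> i))"

definition raising_op :: "nat \<Rightarrow> nat \<Rightarrow> int_seq \<Rightarrow> int_seq" where
  "raising_op i j \<alpha> = \<alpha> + Poly_Mapping.single i 1 - Poly_Mapping.single j 1"

text \<open>
  The action of the squarefree monomial in the raising operators given by a finite set of index
  pairs; see \<open>raising_monomial_insert\<close>.
\<close>

definition raising_monomial :: "(nat \<times> nat) set \<Rightarrow> int_seq \<Rightarrow> int_seq" where
  "raising_monomial S \<alpha> =
     \<alpha> + (\<Sum>(i, j)\<in>S. Poly_Mapping.single i 1 - Poly_Mapping.single j 1)"

lemma raising_monomial_empty: "raising_monomial {} \<alpha> = \<alpha>"
  by (simp add: raising_monomial_def)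

lemma raising_monomial_insert:
  assumes "finite S" "(i, j) \<notin> S"
  shows "raising_monomial (insert (i, j) S) \<alpha> = raising_op i j (raising_monomial S \<alpha>)"
  using assms by (simp add: raising_monomial_def raising_op_def algebra_simps)

text \<open>
  The summands of the formal expansion of the product of all \<open>1 - R\<^sub>i\<^sub>j\<close> with \<open>i < j\<close>, applied to
  \<^term>\<open>u_seq \<alpha>\<close>, are indexed by the finite sets of such pairs. Only finitely many of them are
  nonzero, by \<open>finite_schur_index\<close> below.
\<close>

definition schur_index :: "int_seq \<Rightarrow> (nat \<times> nat) set set" where
  "schur_index \<alpha> =
     {S. finite S \<and> S \<subseteq> {(i, j). i < j} \<and> u_seq (raising_monomial S \<alpha>) \<noteq> 0}"

definition schur_poly :: "int_seq \<Rightarrow> poly_ring" where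
  "schur_poly \<alpha> = (\<Sum>S\<in>schur_index \<alpha>. (- 1) ^ card S * u_seq (raising_monomial S \<alpha>))"

lemma u_seq_neg:
  assumes "Poly_Mapping.lookup \<alpha> i < 0"
  shows "u_seq \<alpha> = 0"
proof -
  have "i \<in> Poly_Mapping.keys \<alpha>" using assms by (simp add: in_keys_iff)
  moreover have "u (Poly_Mapping.lookup \<alpha> i) = 0" using assms by (simp add: u_def)
  ultimately show ?thesis unfolding u_seq_def by (intro prod_zero) auto
qed

lemma finite_schur_index: "finite (schur_index \<alpha>)"
proof -
  obtain n where n: "\<And>i. i \<in> Poly_Mapping.keys \<alpha> \<Longrightarrow> i < n"
    using finite_nat_set_iff_bounded[of "Poly_Mapping.keys \<alpha>"] by auto
  have "S \<subseteq> {..<n} \<times> {..<n}" if S: "S \<in> schur_index \<alpha>" for S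
  proof (rule ccontr)
    have fin: "finite S" and lt: "\<And>i j. (i, j) \<in> S \<Longrightarrow> i < j"
      and nz: "u_seq (raising_monomial S \<alpha>) \<noteq> 0"
      using S by (auto simp: schur_index_def)
    assume "\<not> S \<subseteq> {..<n} \<times> {..<n}"
    then obtain i0 j0 where ij0: "(i0, j0) \<in> S" "j0 \<ge> n"
      using lt by (force simp: not_less)
    define m where "m = Max (snd ` S)"
    have le: "j \<le> m" if "(i, j) \<in> S" for i j
      unfolding m_def using that fin by (intro Max_ge) force+
    have "m \<in> snd ` S" unfolding m_def using fin ij0 by (intro Max_in) auto
    then obtain i1 where i1: "(i1, m) \<in> S" by auto
    have "m \<ge> n" using le[OF ij0(1)] ij0(2) by simp
    hence "Poly_Mapping.lookup \<alpha> m = 0" using n[of m] by (auto simp: in_keys_iff)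
    have fst: "i \<noteq> m" if "(i, j) \<in> S" for i j using lt[OF that] le[OF that] by simp
    let ?f = "\<lambda>p. Poly_Mapping.lookup (case p of (i, j) \<Rightarrow>
                 Poly_Mapping.single i (1::int) - Poly_Mapping.single j 1) m"
    have "Poly_Mapping.lookup (raising_monomial S \<alpha>) m = (\<Sum>p\<in>S. ?f p)"
      by (simp add: raising_monomial_def lookup_add lookup_sum \<open>Poly_Mapping.lookup \<alpha> m = 0\<close>)
    also have "\<dots> = ?f (i1, m) + (\<Sum>p\<in>S - {(i1, m)}. ?f p)"
      using fin i1 by (rule sum.remove)
    also have "(\<Sum>p\<in>S - {(i1, m)}. ?f p) \<le> 0"
    proof (rule sum_nonpos)
      fix p assume "p \<in> S - {(i1, m)}"
      moreover obtain i j where "p = (i, j)" by (cases p)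
      ultimately show "?f p \<le> 0"
        using fst[of i j] by (simp add: lookup_minus lookup_single when_def)
    qed
    also have "?f (i1, m) = - 1"
      using fst[OF i1] by (simp add: lookup_minus lookup_single when_def)
    finally have "Poly_Mapping.lookup (raising_monomial S \<alpha>) m < 0" by simp
    from u_seq_neg[OF this] nz show False by simp
  qed
  hence "schur_index \<alpha> \<subseteq> Pow ({..<n} \<times> {..<n})" by blast
  thus ?thesis by (rule finite_subset) simp
qed


subsection \<open>Structure constants\<close>

text \<open>
  The coefficients of an element with respect to the Schur polynomials of partitions. The
  description is proper because these form a \<open>\<int>\<close>-basis of the ring.
\<close>

definition schur_coeffs :: "poly_ring \<Rightarrow> (int_seq \<Rightarrow>\<^sub>0 int)" where
  "schur_coeffs f = (THE c. Poly_Mapping.keys c \<subseteq> Collect is_partition \<and>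
     f = (\<Sum>\<kappa>\<in>Poly_Mapping.keys c. of_int (Poly_Mapping.lookup c \<kappa>) * schur_poly \<kappa>))"

definition structure_const :: "int_seq \<Rightarrow> int_seq \<Rightarrow> int_seq \<Rightarrow> int" where
  "structure_const \<kappa> \<mu> \<nu> = Poly_Mapping.lookup (schur_coeffs (schur_poly \<mu> * schur_poly \<nu>)) \<kappa>"


subsection \<open>Tableaux\<close>

definition seq_le :: "int_seq \<Rightarrow> int_seq \<Rightarrow> bool" where
  "seq_le \<mu> \<kappa> \<longleftrightarrow> (\<forall>i. Poly_Mapping.lookup \<mu> i \<le> Poly_Mapping.lookup \<kappa> i)"

text \<open>A box is a pair of a row and a column index.\<close>

definition diagram :: "int_seq \<Rightarrow> (nat \<times> nat) set" where
  "diagram \<kappa> = {(i, j). int j < Poly_Mapping.lookup \<kappa> i}"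

definition skew_diagram :: "int_seq \<Rightarrow> int_seq \<Rightarrow> (nat \<times> nat) set" where
  "skew_diagram \<kappa> \<mu> = diagram \<kappa> - diagram \<mu>"

definition ssyt :: "int_seq \<Rightarrow> int_seq \<Rightarrow> (nat \<times> nat \<Rightarrow> nat) set" where
  "ssyt \<kappa> \<mu> = {T. seq_le \<mu> \<kappa> \<and> T \<in> skew_diagram \<kappa> \<mu> \<rightarrow>\<^sub>E {1..} \<and>
     (\<forall>i j j'. (i, j) \<in> skew_diagram \<kappa> \<mu> \<and> (i, j') \<in> skew_diagram \<kappa> \<mu> \<and> j < j' \<longrightarrow>
        T (i, j) \<le> T (i, j')) \<and>
     (\<forall>i i' j. (i, j) \<in> skew_diagram \<kappa> \<mu> \<and> (i', j) \<in> skew_diagram \<kappa> \<mu> \<and> i < i' \<longrightarrow>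
        T (i, j) < T (i', j))}"

text \<open>
  The content of the restriction of a filling to a finite set of boxes. The entries are positive,
  so position \<open>k\<close> of the content counts the entries \<open>k + 1\<close>.
\<close>

definition content_on :: "(nat \<times> nat \<Rightarrow> nat) \<Rightarrow> (nat \<times> nat) set \<Rightarrow> int_seq" where
  "content_on T B = Abs_poly_mapping (\<lambda>k. int (card {b \<in> B. T b = Suc k}))"

definition lr_tableaux :: "int_seq \<Rightarrow> int_seq \<Rightarrow> int_seq \<Rightarrow> (nat \<times> nat \<Rightarrow> nat) set" where
  "lr_tableaux \<kappa> \<mu> \<nu> = {T \<in> ssyt \<kappa> \<mu>. content_on T (skew_diagram \<kappa> \<mu>) = \<nu> \<and>
     (\<forall>r. is_partition (content_on T {(i, j) \<in> skew_diagram \<kappa> \<mu>. r \<le> j}))}"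

lemma lookup_content_on:
  assumes "finite B"
  shows "Poly_Mapping.lookup (content_on T B) k = int (card {b \<in> B. T b = Suc k})"
proof -
  have "{k. int (card {b \<in> B. T b = Suc k}) \<noteq> 0} \<subseteq> (\<lambda>b. T b - 1) ` B"
  proof
    fix k assume "k \<in> {k. int (card {b \<in> B. T b = Suc k}) \<noteq> 0}"
    hence "{b \<in> B. T b = Suc k} \<noteq> {}" by (intro notI) simp
    thus "k \<in> (\<lambda>b. T b - 1) ` B" by force
  qed
  hence "finite {k. int (card {b \<in> B. T b = Suc k}) \<noteq> 0}"
    using assms by (meson finite_imageI finite_subset)
  thus ?thesis by (simp add: content_on_def lookup_Abs_poly_mapping)
qed

lemma finite_diagram: "finite (diagram \<kappa>)"
proof (rule finite_subset)
  show "diagram \<kappa> \<subseteq> (SIGMA i:{i. Poly_Mapping.lookup \<kappa> i \<noteq> 0}. {..<nat (Poly_Mapping.lookup \<kappa> i)})"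
    by (auto simp: diagram_def)
  show "finite (SIGMA i:{i. Poly_Mapping.lookup \<kappa> i \<noteq> 0}. {..<nat (Poly_Mapping.lookup \<kappa> i)})"
    by (intro finite_SigmaI) auto
qed

lemma finite_lr_tableaux: "finite (lr_tableaux \<kappa> \<mu> \<nu>)"
proof -
  let ?D = "skew_diagram \<kappa> \<mu>"
  have fin: "finite ?D" by (simp add: skew_diagram_def finite_diagram)
  have "T \<in> ?D \<rightarrow>\<^sub>E Suc ` Poly_Mapping.keys \<nu>" if T: "T \<in> lr_tableaux \<kappa> \<mu> \<nu>" for T
  proof (rule PiE_I)
    have P: "T \<in> ?D \<rightarrow>\<^sub>E {1..}" and c: "content_on T ?D = \<nu>"
      using T by (auto simp: lr_tableaux_def ssyt_def)
    show "T b = undefined" if "b \<notin> ?D" for b using P that by (rule PiE_arb)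
    show "T b \<in> Suc ` Poly_Mapping.keys \<nu>" if b: "b \<in> ?D" for b
    proof -
      have "T b \<ge> 1" using PiE_mem[OF P b] by simp
      then obtain k where k: "T b = Suc k" by (cases "T b") auto
      have "b \<in> {b \<in> ?D. T b = Suc k}" using b k by simp
      moreover have "finite {b \<in> ?D. T b = Suc k}" using fin by (rule rev_finite_subset) blast
      ultimately have "card {b \<in> ?D. T b = Suc k} \<noteq> 0" by (metis card_0_eq empty_iff)
      hence "k \<in> Poly_Mapping.keys \<nu>" using lookup_content_on[OF fin, of T k] c by (simp add: in_keys_iff)
      thus ?thesis using k by simp
    qed
  qed
  hence "lr_tableaux \<kappa> \<mu> \<nu> \<subseteq> ?D \<rightarrow>\<^sub>E Suc ` Poly_Mapping.keys \<nu>" by blast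
  thus ?thesis by (rule finite_subset) (intro finite_PiE fin, simp)
qed

end

theory Submission
  imports Defs "Jordan_Normal_Form.Determinant" "HOL-Library.Multiset"
begin

text \<open>
  The coefficient of \<open>U\<^sub>\<kappa>\<close> in \<open>U\<^sub>\<mu> U\<^sub>\<nu>\<close> is computed by two rounds of cancellation. Raising operators become
  multiplication by Laurent monomials \<open>x\<^sub>i / x\<^sub>j\<close> in the group ring of the integer sequences, so
  \<open>U\<^sub>\<alpha>\<close> is the image of \<open>x\<^sup>\<alpha>\<close> times a Vandermonde product. Expanding that product gives the
  Jacobi-Trudi formula (\<open>jacobi_trudi\<close>), in which the symmetric group acts on \<open>\<alpha>\<close> by the dot
  action; hence \<open>U\<^sub>\<alpha>\<close> changes sign when two adjacent entries \<open>(a, b)\<close> become \<open>(b - 1, a + 1)\<close>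
  (\<open>schur_poly_dot_action\<close>).

  Splitting off one variable by a geometric series writes \<open>u\<^sub>p U\<^sub>\<mu>\<close> as the sum of \<open>U\<^sub>\<alpha>\<close> over all ways
  of adding \<open>p\<close> boxes to the rows of \<open>\<mu>\<close>, and the antisymmetry cancels everything but horizontal strips
  (\<open>pieri\<close>). Applying this to every monomial of the Jacobi-Trudi expansion of \<open>U\<^sub>\<nu>\<close> expresses the
  structure constant as a signed count of chains of horizontal strips from \<open>\<mu>\<close> to \<open>\<kappa>\<close>, that is, of
  semistandard tableaux of shape \<open>\<kappa>/\<mu>\<close> whose content is in the dot orbit of \<open>\<nu>\<close>
  (\<open>structure_const_signed_chains\<close>). Reading off the coefficient is legitimate because the Schur
  polynomials of partitions are linearly independent (\<open>schur_poly_independent\<close>).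

  The remaining cancellation is Stembridge's. If some column \<open>r\<close> violates the lattice condition, take the
  rightmost such column and the least pair of consecutive entries \<open>k\<close>, \<open>k + 1\<close> violating it there, and exchange
  the numbers of these two entries to the left of column \<open>r\<close> by a Bender-Knuth move. On
  chains of partitions the move is a reflection of each row of one partition in the interval that its two
  neighbours leave free, truncated at column \<open>r\<close>; it is an involution which acts on the content by
  an adjacent transposition of the dot action, hence reverses the sign (\<open>sign_reversal\<close>). In a surviving
  tableau the content is itself a partition, and \<open>\<nu>\<close> is the only partition in its dot orbit, which leaves
  exactly the tableaux of the theorem.
\<close>


section \<open>The Vandermonde determinant\<close>

lemma det_unitriangular:
  fixes A :: "'a::comm_ring_1 mat"
  assumes "A \<in> carrier_mat n n" and "upper_triangular A" and "\<And>i. i < n \<Longrightarrow> A $$ (i, i) = 1"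
  shows "det A = 1"
  using det_upper_triangular[OF assms(2,1)] assms(1,3) by (simp add: prod_list_diag_prod)

text \<open>
  Subtracting \<open>y\<^sub>n\<close> times each column from the next one is multiplication by a unitriangular matrix. It
  turns the last row into \<open>(1, 0, ..., 0)\<close> and pulls a factor \<open>y\<^sub>i - y\<^sub>n\<close> out of each other row.
\<close>

lemma det_vandermonde:
  fixes y :: "nat \<Rightarrow> 'a::comm_ring_1"
  shows "det (mat n n (\<lambda>(i, j). y i ^ j)) = (\<Prod>j<n. \<Prod>i<j. y j - y i)"
proof (induction n)
  case 0
  show ?case by simp
next
  case (Suc n)
  let ?N = "Suc n"
  define A where "A = mat ?N ?N (\<lambda>(i, j). y i ^ j)"
  define E where "E = mat ?N ?N (\<lambda>(i, j). if i = j then 1 else if Suc i = j then - y n else 0)"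
  define B where "B = mat ?N ?N (\<lambda>(i, j). if j = 0 then 1 else (y i - y n) * y i ^ (j - 1))"
  have carr: "A \<in> carrier_mat ?N ?N" "E \<in> carrier_mat ?N ?N" "B \<in> carrier_mat ?N ?N"
    by (simp_all add: A_def E_def B_def)
  have "A * E = B"
  proof (rule eq_matI)
    fix i j assume "i < dim_row B" "j < dim_col B"
    hence ij: "i < ?N" "j < ?N" by (simp_all add: B_def)
    have "(A * E) $$ (i, j) = (\<Sum>k<?N. y i ^ k * (if k = j then 1 else if Suc k = j then - y n else 0))"
      using ij by (simp add: A_def E_def scalar_prod_def lessThan_atLeast0)
    also have "\<dots> = (\<Sum>k<?N. (if k = j then y i ^ k else 0)) +
        (\<Sum>k<?N. if Suc k = j then - (y n * y i ^ k) else 0)"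
      unfolding sum.distrib[symmetric] by (rule sum.cong) (auto simp: mult.commute)
    also have "(\<Sum>k<?N. if Suc k = j then - (y n * y i ^ k) else 0) = (if j = 0 then 0 else - (y n * y i ^ (j - 1)))"
    proof (cases j)
      case (Suc j')
      thus ?thesis using ij by (simp del: sum.lessThan_Suc)
    qed (simp del: sum.lessThan_Suc)
    also have "(\<Sum>k<?N. (if k = j then y i ^ k else 0)) = y i ^ j"
      using ij by (simp del: sum.lessThan_Suc)
    also have "y i ^ j + (if j = 0 then 0 else - (y n * y i ^ (j - 1))) = B $$ (i, j)"
      using ij by (cases j) (simp_all add: B_def algebra_simps)
    finally show "(A * E) $$ (i, j) = B $$ (i, j)" .
  qed (simp_all add: A_def B_def E_def)
  moreover have "det E = 1"
    using carr(2) by (rule det_unitriangular) (auto simp: E_def upper_triangular_def)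
  ultimately have "det A = det B" using det_mult[OF carr(1,2)] by simp
  also have "\<dots> = (\<Sum>j<?N. B $$ (n, j) * cofactor B n j)"
    using carr(3) by (intro laplace_expansion_row) auto
  also have "\<dots> = cofactor B n 0"
    by (subst sum.lessThan_Suc_shift) (simp add: B_def)
  also have "\<dots> = (-1) ^ n * det (mat_delete B n 0)" by (simp add: cofactor_def)
  also have "mat_delete B n 0 =
      mat n n (\<lambda>(i, j). if i = j then y i - y n else 0) * mat n n (\<lambda>(i, j). y i ^ j)" (is "_ = ?D * ?V")
  proof (rule eq_matI)
    fix i j assume "i < dim_row (?D * ?V)" "j < dim_col (?D * ?V)"
    hence ij: "i < n" "j < n" by simp_all
    have "(?D * ?V) $$ (i, j) = (\<Sum>k<n. (if i = k then y i - y n else 0) * y k ^ j)"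
      using ij by (simp add: scalar_prod_def lessThan_atLeast0)
    also have "\<dots> = (\<Sum>k<n. if k = i then (y i - y n) * y i ^ j else 0)"
      by (rule sum.cong) auto
    also have "\<dots> = (y i - y n) * y i ^ j" using ij by simp
    finally show "mat_delete B n 0 $$ (i, j) = (?D * ?V) $$ (i, j)"
      using ij by (simp add: mat_delete_def B_def)
  qed (simp_all add: mat_delete_def B_def)
  also have "det (?D * ?V) = det ?D * det ?V" by (rule det_mult) auto
  also have "det ?D = prod_list (diag_mat ?D)"
    by (rule det_upper_triangular[of _ n]) (auto simp: upper_triangular_def)
  also have "\<dots> = (\<Prod>i<n. y i - y n)" by (simp add: prod_list_diag_prod lessThan_atLeast0)
  finally have "det A = ((-1) ^ n * (\<Prod>i<n. y i - y n)) * det ?V" by (simp add: mult.assoc)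
  also have "(-1) ^ n * (\<Prod>i<n. y i - y n) = (\<Prod>i<n. y n - y i)"
    using prod_uminus[of "\<lambda>i. y i - y n" "{..<n}"] by simp
  finally show ?case by (simp add: A_def Suc mult.commute)
qed

lemma vandermonde_expansion:
  fixes y :: "nat \<Rightarrow> 'a::comm_ring_1"
  shows "(\<Prod>j<n. \<Prod>i<j. y j - y i) =
    (\<Sum>\<sigma> | \<sigma> permutes {..<n}. of_int (sign \<sigma>) * (\<Prod>i<n. y i ^ \<sigma> i))"
proof -
  have "det (mat n n (\<lambda>(i, j). y i ^ j)) =
      (\<Sum>\<sigma> | \<sigma> permutes {..<n}. of_int (sign \<sigma>) * (\<Prod>i<n. y i ^ \<sigma> i))"
    unfolding det_def lessThan_atLeast0
    by (auto intro!: sum.cong prod.cong arg_cong2[where f = "(*)"] simp: permutes_in_image)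
  thus ?thesis by (simp add: det_vandermonde)
qed


section \<open>Raising operators as Laurent monomials and the Jacobi-Trudi formula\<close>

abbreviation unit_seq :: "nat \<Rightarrow> int_seq" where "unit_seq i \<equiv> Poly_Mapping.single i 1"

type_synonym laurent = "int_seq \<Rightarrow>\<^sub>0 int"

text \<open>
  The additive map \<open>x\<^sup>\<alpha> \<mapsto> u\<^sub>\<alpha>\<close>. It is not multiplicative: products of raising operators are formed
  on the left before \<open>u\<close> is applied, in accordance with \<open>R u\<^sub>\<alpha> = u\<^sub>R\<^sub>\<alpha>\<close>.
\<close>

abbreviation to_ring :: "laurent \<Rightarrow> poly_ring" where "to_ring \<equiv> frag_extend u_seq"

text \<open>
  The product of all \<open>1 - R\<^sub>i\<^sub>j\<close> with \<open>i < j < n\<close>, the operator \<open>R\<^sub>i\<^sub>j\<close> being multiplication by \<open>x\<^sub>i / x\<^sub>j\<close>.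
\<close>

definition raising_product :: "nat \<Rightarrow> laurent" where
  "raising_product n = (\<Prod>j<n. \<Prod>i<j. 1 - frag_of (unit_seq i - unit_seq j))"

lemma frag_of_add: "frag_of (\<alpha> + \<beta>) = frag_of \<alpha> * frag_of (\<beta> :: 'a::monoid_add)"
  by (simp add: mult_single)

lemma frag_of_sum: "frag_of (\<Sum>x\<in>A. f x) = (\<Prod>x\<in>A. frag_of (f x :: 'a::comm_monoid_add))"
  by (induction A rule: infinite_finite_induct) (simp_all add: frag_of_add)

lemma frag_of_single_power: "frag_of (unit_seq i) ^ k = frag_of (Poly_Mapping.single i (int k))"
  by (induction k) (simp_all add: mult_single single_add[symmetric])

lemma frag_of_single_diff_power:
  "frag_of (unit_seq i - unit_seq j) ^ k = frag_of (Poly_Mapping.single i (int k) - Poly_Mapping.single j (int k))"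
  by (induction k) (simp_all add: mult_single single_add algebra_simps)

lemma frag_cmul_conv_mult: "frag_cmul c f = of_int c * (f :: 'a::monoid_add \<Rightarrow>\<^sub>0 int)"
  by (induction c rule: int_induct[where k = 0])
     (simp_all add: frag_cmul_distrib frag_cmul_diff_distrib algebra_simps)

lemma to_ring_of_int: "to_ring (of_int c * f) = of_int c * to_ring f"
  by (simp add: frag_cmul_conv_mult[symmetric] frag_extend_cmul)

lemma to_ring_sign: "to_ring ((-1) ^ k * f) = (-1) ^ k * to_ring f"
  using to_ring_of_int[of "(-1) ^ k" f] by simp

definition supported_below :: "nat \<Rightarrow> laurent \<Rightarrow> bool" where
  "supported_below n f \<longleftrightarrow> (\<forall>\<alpha>\<in>Poly_Mapping.keys f. Poly_Mapping.keys \<alpha> \<subseteq> {..<n})"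

lemma supported_below_mult:
  assumes "supported_below n f" "supported_below n g" shows "supported_below n (f * g)"
  unfolding supported_below_def
proof
  fix \<gamma> assume "\<gamma> \<in> Poly_Mapping.keys (f * g)"
  then obtain \<alpha> \<beta> where "\<gamma> = \<alpha> + \<beta>" "\<alpha> \<in> Poly_Mapping.keys f" "\<beta> \<in> Poly_Mapping.keys g"
    using keys_mult[of f g] by auto
  thus "Poly_Mapping.keys \<gamma> \<subseteq> {..<n}"
    using keys_add[of \<alpha> \<beta>] assms unfolding supported_below_def by blast
qed

lemma supported_below_prod:
  "(\<And>x. x \<in> A \<Longrightarrow> supported_below n (f x)) \<Longrightarrow> supported_below n (\<Prod>x\<in>A. f x)"
  by (induction A rule: infinite_finite_induct)
     (auto simp: supported_below_mult, auto simp: supported_below_def)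

lemma supported_below_raising_product: "supported_below n (raising_product n)"
  unfolding raising_product_def
proof (intro supported_below_prod)
  fix i j assume "i \<in> {..<j}" "j \<in> {..<n}"
  hence "Poly_Mapping.keys (unit_seq i - unit_seq j) \<subseteq> {..<n}" using keys_diff[of "unit_seq i" "unit_seq j"] by auto
  thus "supported_below n (1 - frag_of (unit_seq i - unit_seq j))"
    unfolding supported_below_def using keys_diff[of 1 "frag_of (unit_seq i - unit_seq j)"] by auto
qed

definition exponents_less :: "nat \<Rightarrow> int \<Rightarrow> laurent \<Rightarrow> bool" where
  "exponents_less n d f \<longleftrightarrow> (\<forall>\<alpha>\<in>Poly_Mapping.keys f. Poly_Mapping.lookup \<alpha> n < d)"

lemma exponents_less_mult:
  assumes "exponents_less n c f" "\<And>\<beta>. \<beta> \<in> Poly_Mapping.keys g \<Longrightarrow> Poly_Mapping.lookup \<beta> n \<le> d"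
  shows "exponents_less n (c + d) (f * g)"
  unfolding exponents_less_def
proof
  fix \<gamma> assume "\<gamma> \<in> Poly_Mapping.keys (f * g)"
  then obtain \<alpha> \<beta> where "\<gamma> = \<alpha> + \<beta>" "\<alpha> \<in> Poly_Mapping.keys f" "\<beta> \<in> Poly_Mapping.keys g"
    using keys_mult[of f g] by auto
  thus "Poly_Mapping.lookup \<gamma> n < c + d"
    using assms unfolding exponents_less_def by (fastforce simp: lookup_add)
qed

lemma exponents_less_mult_prod:
  assumes "exponents_less n c f" "n \<notin> B"
  shows "exponents_less n c (f * (\<Prod>i\<in>B. 1 - frag_of (unit_seq i - unit_seq n) ^ N))"
  using assms(2)
proof (induction B rule: infinite_finite_induct)
  case (insert b B)
  let ?g = "1 - frag_of (unit_seq b - unit_seq n) ^ N"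
  have "Poly_Mapping.lookup \<beta> n \<le> 0" if "\<beta> \<in> Poly_Mapping.keys ?g" for \<beta>
  proof -
    have "\<beta> = 0 \<or> \<beta> = Poly_Mapping.single b (int N) - Poly_Mapping.single n (int N)"
      using that keys_diff[of 1 "frag_of (unit_seq b - unit_seq n) ^ N"] unfolding frag_of_single_diff_power by auto
    thus ?thesis using insert.prems by (auto simp: lookup_minus lookup_single when_def)
  qed
  hence "exponents_less n (c + 0) (f * (\<Prod>i\<in>B. 1 - frag_of (unit_seq i - unit_seq n) ^ N) * ?g)"
    using insert.prems by (intro exponents_less_mult insert.IH) auto
  thus ?case using insert.hyps by (simp add: ac_simps)
qed (use assms(1) in auto)

lemma to_ring_eq_0: "exponents_less n 0 f \<Longrightarrow> to_ring f = 0"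
  unfolding exponents_less_def by (intro frag_extend_eq_0 u_seq_neg) auto

text \<open>
  A factor \<open>x\<^sub>b\<^sup>N / x\<^sub>n\<^sup>N\<close> makes the exponent of \<open>x\<^sub>n\<close> negative in every monomial of \<open>f\<close>, and
  such monomials are killed because \<open>u\<close> vanishes at negative indices. So each factor may be replaced by \<open>1\<close>. With
  \<open>N = 1\<close> this shows that \<open>U\<^sub>\<alpha>\<close> does not depend on the number of variables; with \<open>N = p + 1\<close>
  it truncates the geometric series in the Pieri rule.
\<close>

lemma to_ring_mult_prod:
  assumes "exponents_less n (int N) f" "finite B" "n \<notin> B"
  shows "to_ring (f * (\<Prod>i\<in>B. 1 - frag_of (unit_seq i - unit_seq n) ^ N)) = to_ring f"
  using assms(2,3)
proof (induction B rule: finite_induct)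
  case (insert b B)
  let ?P = "\<Prod>i\<in>B. 1 - frag_of (unit_seq i - unit_seq n) ^ N" and ?t = "frag_of (unit_seq b - unit_seq n) ^ N"
  have "exponents_less n (int N + (- int N)) (f * ?t)"
    using assms(1) insert.prems
    by (intro exponents_less_mult) (auto simp: frag_of_single_diff_power lookup_minus lookup_single when_def)
  hence "to_ring (f * ?t * ?P) = 0"
    using insert.prems by (intro to_ring_eq_0[of n] exponents_less_mult_prod) auto
  moreover have "f * (\<Prod>i\<in>insert b B. 1 - frag_of (unit_seq i - unit_seq n) ^ N) = f * ?P - f * ?t * ?P"
    using insert.hyps by (simp add: algebra_simps)
  ultimately show ?case using insert by (simp add: frag_extend_diff)
qed simp

lemma raising_product_Suc:
  "raising_product (Suc n) = raising_product n * (\<Prod>i<n. 1 - frag_of (unit_seq i - unit_seq n))"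
  by (simp add: raising_product_def)

lemma exponents_less_raising_product:
  assumes "Poly_Mapping.lookup \<alpha> n < c"
  shows "exponents_less n c (frag_of \<alpha> * raising_product n)"
proof -
  have "exponents_less n c (frag_of \<alpha>)" using assms by (simp add: exponents_less_def)
  moreover have "Poly_Mapping.lookup \<beta> n \<le> 0" if "\<beta> \<in> Poly_Mapping.keys (raising_product n)" for \<beta>
    using that supported_below_raising_product[of n] unfolding supported_below_def
    by (metis eq_refl in_keys_iff lessThan_iff less_irrefl subsetD)
  ultimately have "exponents_less n (c + 0) (frag_of \<alpha> * raising_product n)"
    by (rule exponents_less_mult)
  thus ?thesis by simp
qed

lemma raising_product_stable:
  assumes "Poly_Mapping.keys \<alpha> \<subseteq> {..<n}" "n \<le> m"
  shows "to_ring (frag_of \<alpha> * raising_product m) = to_ring (frag_of \<alpha> * raising_product n)"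
  using assms(2)
proof (induction m rule: dec_induct)
  case (step m)
  have "Poly_Mapping.lookup \<alpha> m = 0" using assms(1) step(1) by (force simp: in_keys_iff)
  hence "exponents_less m (int 1) (frag_of \<alpha> * raising_product m)"
    by (intro exponents_less_raising_product) simp
  from to_ring_mult_prod[OF this, of "{..<m}"]
  have "to_ring (frag_of \<alpha> * raising_product (Suc m)) = to_ring (frag_of \<alpha> * raising_product m)"
    by (simp add: raising_product_Suc mult.assoc)
  thus ?case using step by simp
qed simp

lemma to_ring_raising_product:
  "to_ring (frag_of \<alpha> * raising_product n) =
    (\<Sum>S\<in>Pow {(i, j). i < j \<and> j < n}. (- 1) ^ card S * u_seq (raising_monomial S \<alpha>))"
proof -
  let ?P = "{(i, j). i < j \<and> j < n}" and ?v = "\<lambda>(i, j). unit_seq i - unit_seq j"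
  have fin: "finite ?P" by (rule finite_subset[of _ "{..<n} \<times> {..<n}"]) auto
  have "raising_product n = (\<Prod>(j, i)\<in>(SIGMA j:{..<n}. {..<j}). 1 - frag_of (unit_seq i - unit_seq j))"
    unfolding raising_product_def by (rule prod.Sigma) auto
  also have "\<dots> = (\<Prod>p\<in>?P. - frag_of (?v p) + 1)"
    by (rule prod.reindex_bij_witness[of _ prod.swap prod.swap]) auto
  also have "\<dots> = (\<Sum>S\<in>Pow ?P. \<Prod>p\<in>S. - frag_of (?v p))"
    using fin by (subst prod_add) simp_all
  also have "\<dots> = (\<Sum>S\<in>Pow ?P. (-1) ^ card S * frag_of (\<Sum>p\<in>S. ?v p))"
    by (simp add: prod_uminus frag_of_sum)
  finally have "frag_of \<alpha> * raising_product n = (\<Sum>S\<in>Pow ?P. (-1) ^ card S * frag_of (raising_monomial S \<alpha>))"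
    by (simp add: sum_distrib_left raising_monomial_def frag_of_add algebra_simps case_prod_unfold)
  thus ?thesis using fin by (simp add: frag_extend_sum to_ring_sign o_def)
qed

lemma schur_poly_eq_to_ring:
  assumes "Poly_Mapping.keys \<alpha> \<subseteq> {..<n}"
  shows "schur_poly \<alpha> = to_ring (frag_of \<alpha> * raising_product n)"
proof -
  have "finite (\<Union>S\<in>schur_index \<alpha>. snd ` S)"
    using finite_schur_index by (auto simp: schur_index_def)
  then obtain m where m: "\<And>j. j \<in> (\<Union>S\<in>schur_index \<alpha>. snd ` S) \<Longrightarrow> j < m"
    using finite_nat_set_iff_bounded by (metis (no_types, lifting))
  \<comment> \<open>Enough variables to contain all pairs of indices that contribute to \<open>U\<^sub>\<alpha>\<close>.\<close>
  define N where "N = max n m"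
  have fin: "finite {(i, j). i < j \<and> j < N}"
    by (rule finite_subset[of _ "{..<N} \<times> {..<N}"]) auto
  have "schur_index \<alpha> \<subseteq> Pow {(i, j). i < j \<and> j < N}"
  proof
    fix S assume S: "S \<in> schur_index \<alpha>"
    show "S \<in> Pow {(i, j). i < j \<and> j < N}"
    proof (intro PowI subrelI)
      fix i j assume ij: "(i, j) \<in> S"
      have "j \<in> snd ` S" using ij by (metis image_eqI snd_conv)
      hence "j < m" using S by (intro m) blast
      moreover have "i < j" using S ij by (auto simp: schur_index_def)
      ultimately show "(i, j) \<in> {(i, j). i < j \<and> j < N}" by (simp add: N_def)
    qed
  qed
  hence "schur_poly \<alpha> = (\<Sum>S\<in>Pow {(i, j). i < j \<and> j < N}. (- 1) ^ card S * u_seq (raising_monomial S \<alpha>))"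
    unfolding schur_poly_def using fin finite_subset[OF _ fin]
    by (intro sum.mono_neutral_left) (auto simp: schur_index_def)
  also have "\<dots> = to_ring (frag_of \<alpha> * raising_product N)" by (simp add: to_ring_raising_product)
  also have "\<dots> = to_ring (frag_of \<alpha> * raising_product n)"
    using assms by (intro raising_product_stable) (simp_all add: N_def)
  finally show ?thesis .
qed

definition staircase :: "nat \<Rightarrow> int_seq" where
  "staircase n = (\<Sum>i<n. Poly_Mapping.single i (int i))"

text \<open>
  The permutation action centred at the staircase. Permutations of \<open>{..<n}\<close> preserve
  \<open>{..<n}\<close>, so truncating the staircase at \<open>n\<close> keeps the supports finite and leaves the formula in
  \<open>lookup_dot_action\<close> independent of \<open>n\<close>.
\<close>

definition dot_action :: "nat \<Rightarrow> (nat \<Rightarrow> nat) \<Rightarrow> int_seq \<Rightarrow> int_seq" where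
  "dot_action n \<sigma> \<alpha> = Poly_Mapping.map_key \<sigma> (\<alpha> - staircase n) + staircase n"

lemma lookup_sum_single:
  fixes n :: nat
  shows "Poly_Mapping.lookup (\<Sum>i<n. Poly_Mapping.single i (f i)) k = (if k < n then f k else 0)"
  by (induction n) (auto simp: lookup_add lookup_single when_def less_Suc_eq)

lemma lookup_map_key: "inj \<sigma> \<Longrightarrow> Poly_Mapping.lookup (Poly_Mapping.map_key \<sigma> \<alpha>) i = Poly_Mapping.lookup \<alpha> (\<sigma> i)"
  by (simp add: map_key.rep_eq)

lemma lookup_dot_action:
  assumes "\<sigma> permutes {..<n}"
  shows "Poly_Mapping.lookup (dot_action n \<sigma> \<alpha>) i = Poly_Mapping.lookup \<alpha> (\<sigma> i) - int (\<sigma> i) + int i"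
proof (cases "i < n")
  case True
  hence "\<sigma> i < n" using permutes_in_image[OF assms, of i] by simp
  thus ?thesis using True permutes_inj[OF assms]
    by (simp add: dot_action_def lookup_add lookup_map_key lookup_minus staircase_def lookup_sum_single)
next
  case False
  hence "\<sigma> i = i" using assms by (auto simp: permutes_def)
  thus ?thesis using False permutes_inj[OF assms]
    by (simp add: dot_action_def lookup_add lookup_map_key lookup_minus staircase_def lookup_sum_single)
qed

lemma keys_dot_action:
  assumes "\<sigma> permutes {..<n}" "Poly_Mapping.keys \<alpha> \<subseteq> {..<n}"
  shows "Poly_Mapping.keys (dot_action n \<sigma> \<alpha>) \<subseteq> {..<n}"
proof
  fix i assume i: "i \<in> Poly_Mapping.keys (dot_action n \<sigma> \<alpha>)"
  show "i \<in> {..<n}"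
  proof (rule ccontr)
    assume "i \<notin> {..<n}"
    hence "\<sigma> i = i" "Poly_Mapping.lookup \<alpha> i = 0"
      using assms by (auto simp: permutes_def in_keys_iff)
    thus False using i by (simp add: in_keys_iff lookup_dot_action[OF assms(1)])
  qed
qed

lemma dot_action_compose:
  assumes "\<sigma> permutes {..<n}" "\<tau> permutes {..<n}"
  shows "dot_action n \<tau> (dot_action n \<sigma> \<alpha>) = dot_action n (\<sigma> \<circ> \<tau>) \<alpha>"
  by (rule poly_mapping_eqI)
     (simp add: lookup_dot_action assms permutes_compose[OF assms(2,1)])

lemma u_seq_map_key:
  assumes "bij \<sigma>"
  shows "u_seq (Poly_Mapping.map_key \<sigma> \<alpha>) = u_seq \<alpha>"
proof -
  have "bij_betw \<sigma> (\<sigma> -` Poly_Mapping.keys \<alpha>) (Poly_Mapping.keys \<alpha>)"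
    using assms by (auto simp: bij_betw_def inj_on_def bij_def surj_image_vimage_eq)
  from prod.reindex_bij_betw[OF this, of "\<lambda>i. u (Poly_Mapping.lookup \<alpha> i)"] show ?thesis
    using bij_is_inj[OF assms] by (simp add: u_seq_def keys_map_key lookup_map_key)
qed

text \<open>
  The staircase clears all denominators and turns the raising product into a Vandermonde product.
\<close>

lemma staircase_raising_product:
  "frag_of (staircase n) * raising_product n = (\<Prod>j<n. \<Prod>i<j. frag_of (unit_seq j) - frag_of (unit_seq i))"
proof -
  have "frag_of (Poly_Mapping.single j (int j)) * (\<Prod>i<j. 1 - frag_of (unit_seq i - unit_seq j)) =
      (\<Prod>i<j. frag_of (unit_seq j) - frag_of (unit_seq i))" for j
  proof -
    have "frag_of (Poly_Mapping.single j (int j)) = (\<Prod>i<j. frag_of (unit_seq j))"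
      by (simp add: frag_of_single_power)
    moreover have "frag_of (unit_seq j) * (1 - frag_of (unit_seq i - unit_seq j)) = frag_of (unit_seq j) - frag_of (unit_seq i)" for i
      by (simp add: right_diff_distrib frag_of_add[symmetric])
    ultimately show ?thesis by (simp only: prod.distrib[symmetric])
  qed
  thus ?thesis
    by (simp add: staircase_def frag_of_sum raising_product_def prod.distrib[symmetric])
qed

text \<open>
  The usual determinant, up to transposition. The Vandermonde expansion permutes the entries of the staircase
  and not those of \<open>\<alpha>\<close>; as \<open>u_seq\<close> is symmetric, the permutation may be moved to the other summand.
\<close>

theorem jacobi_trudi:
  assumes "Poly_Mapping.keys \<alpha> \<subseteq> {..<n}"
  shows "schur_poly \<alpha> = (\<Sum>\<sigma> | \<sigma> permutes {..<n}. of_int (sign \<sigma>) * u_seq (dot_action n \<sigma> \<alpha>))"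
proof -
  let ?\<beta> = "\<lambda>\<sigma>. \<alpha> - staircase n + (\<Sum>i<n. Poly_Mapping.single i (int (\<sigma> i)))"
  have fin: "finite {\<sigma>. \<sigma> permutes {..<n}}" by (simp add: finite_permutations)
  have "frag_of \<alpha> * raising_product n =
      frag_of (\<alpha> - staircase n) * (frag_of (staircase n) * raising_product n)"
    by (simp add: mult.assoc[symmetric] frag_of_add[symmetric])
  also have "\<dots> = (\<Sum>\<sigma> | \<sigma> permutes {..<n}. of_int (sign \<sigma>) * frag_of (?\<beta> \<sigma>))"
    unfolding staircase_raising_product vandermonde_expansion
    by (simp add: sum_distrib_left frag_of_single_power frag_of_add frag_of_sum mult.left_commute)
  finally have "schur_poly \<alpha> = (\<Sum>\<sigma> | \<sigma> permutes {..<n}. of_int (sign \<sigma>) * u_seq (?\<beta> \<sigma>))"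
    using fin by (simp add: schur_poly_eq_to_ring[OF assms] frag_extend_sum to_ring_of_int o_def)
  also have "\<dots> = (\<Sum>\<sigma> | \<sigma> permutes {..<n}. of_int (sign (Hilbert_Choice.inv \<sigma>)) * u_seq (?\<beta> (Hilbert_Choice.inv \<sigma>)))"
    by (rule sum_permutations_inverse)
  also have "\<dots> = (\<Sum>\<sigma> | \<sigma> permutes {..<n}. of_int (sign \<sigma>) * u_seq (dot_action n \<sigma> \<alpha>))"
  proof (rule sum.cong[OF refl])
    fix \<sigma> assume "\<sigma> \<in> {\<sigma>. \<sigma> permutes {..<n}}"
    hence p: "\<sigma> permutes {..<n}" by simp
    have "Poly_Mapping.map_key \<sigma> (?\<beta> (Hilbert_Choice.inv \<sigma>)) = dot_action n \<sigma> \<alpha>"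
    proof (rule poly_mapping_eqI)
      fix i
      have "\<sigma> i < n \<longleftrightarrow> i < n" using permutes_in_image[OF p, of i] by simp
      moreover have "\<sigma> i = i" if "\<not> i < n" using p that by (auto simp: permutes_def)
      ultimately show "Poly_Mapping.lookup (Poly_Mapping.map_key \<sigma> (?\<beta> (Hilbert_Choice.inv \<sigma>))) i = Poly_Mapping.lookup (dot_action n \<sigma> \<alpha>) i"
        using permutes_inj[OF p] p
        by (auto simp: lookup_map_key lookup_dot_action lookup_add lookup_minus staircase_def lookup_sum_single
            permutes_inverses)
    qed
    hence "u_seq (?\<beta> (Hilbert_Choice.inv \<sigma>)) = u_seq (dot_action n \<sigma> \<alpha>)"
      using u_seq_map_key[OF permutes_bij[OF p]] by metis
    moreover have "sign (Hilbert_Choice.inv \<sigma>) = sign \<sigma>"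
      using permutes_imp_permutation[OF _ p] by (simp add: sign_inverse)
    ultimately show "of_int (sign (Hilbert_Choice.inv \<sigma>)) * u_seq (?\<beta> (Hilbert_Choice.inv \<sigma>)) = of_int (sign \<sigma>) * u_seq (dot_action n \<sigma> \<alpha>)"
      by simp
  qed
  finally show ?thesis .
qed

lemma transpose_permutes: "Suc k < n \<Longrightarrow> transpose k (Suc k) permutes {..<n}"
  by (intro permutes_swap_id) auto

lemma sign_compose_transpose:
  assumes "\<sigma> permutes {..<n}"
  shows "sign (\<sigma> \<circ> transpose k (Suc k)) = - sign \<sigma>"
    and "sign (transpose k (Suc k) \<circ> \<sigma>) = - sign \<sigma>"
  using permutes_imp_permutation[OF _ assms]
  by (simp_all add: sign_compose permutation_swap_id sign_swap_id)

theorem schur_poly_dot_action: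
  assumes "Poly_Mapping.keys \<alpha> \<subseteq> {..<n}" "Suc k < n"
  shows "schur_poly (dot_action n (transpose k (Suc k)) \<alpha>) = - schur_poly \<alpha>"
proof -
  let ?\<tau> = "transpose k (Suc k)"
  have \<tau>: "?\<tau> permutes {..<n}" using assms(2) by (rule transpose_permutes)
  have "schur_poly (dot_action n ?\<tau> \<alpha>) =
      (\<Sum>\<sigma> | \<sigma> permutes {..<n}. of_int (sign \<sigma>) * u_seq (dot_action n \<sigma> (dot_action n ?\<tau> \<alpha>)))"
    using assms \<tau> by (intro jacobi_trudi keys_dot_action)
  also have "\<dots> = (\<Sum>\<sigma> | \<sigma> permutes {..<n}. - (of_int (sign (?\<tau> \<circ> \<sigma>)) * u_seq (dot_action n (?\<tau> \<circ> \<sigma>) \<alpha>)))"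
    using \<tau> by (intro sum.cong) (auto simp: dot_action_compose sign_compose_transpose)
  also have "\<dots> = - (\<Sum>\<sigma> | \<sigma> permutes {..<n}. of_int (sign \<sigma>) * u_seq (dot_action n \<sigma> \<alpha>))"
    unfolding sum_negf by (subst setum_permutations_compose_left[OF \<tau>]) (rule refl)
  also have "\<dots> = - schur_poly \<alpha>" using jacobi_trudi[OF assms(1)] by simp
  finally show ?thesis .
qed


section \<open>The Pieri rule\<close>

definition total :: "int_seq \<Rightarrow> int" where
  "total \<alpha> = (\<Sum>i\<in>Poly_Mapping.keys \<alpha>. Poly_Mapping.lookup \<alpha> i)"

text \<open>
  Interlacing, i.e. \<open>\<beta>/\<alpha>\<close> has at most one box in each column. It forces both sequences to be
  partitions, see \<open>horizontal_strip_partition\<close>.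
\<close>

definition horizontal_strip :: "int_seq \<Rightarrow> int_seq \<Rightarrow> bool" where
  "horizontal_strip \<alpha> \<beta> \<longleftrightarrow> (\<forall>i. Poly_Mapping.lookup \<beta> (Suc i) \<le> Poly_Mapping.lookup \<alpha> i
      \<and> Poly_Mapping.lookup \<alpha> i \<le> Poly_Mapping.lookup \<beta> i)"

lemma keys_bounded: obtains n where "Poly_Mapping.keys (\<alpha> :: int_seq) \<subseteq> {..<n}"
  using finite_nat_set_iff_bounded[of "Poly_Mapping.keys \<alpha>"] by auto

lemma lookup_beyond: "Poly_Mapping.keys (\<alpha> :: int_seq) \<subseteq> {..<n} \<Longrightarrow> n \<le> i \<Longrightarrow> Poly_Mapping.lookup \<alpha> i = 0"
  by (metis in_keys_iff lessThan_iff not_le subsetD)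

lemma total_eq_sum:
  "Poly_Mapping.keys \<alpha> \<subseteq> {..<n} \<Longrightarrow> total \<alpha> = (\<Sum>i<n. Poly_Mapping.lookup \<alpha> i)"
  unfolding total_def by (rule sum.mono_neutral_left) (auto simp: in_keys_iff)

lemma antimono_seq_nonneg:
  assumes "\<And>i. Poly_Mapping.lookup \<alpha> (Suc i) \<le> Poly_Mapping.lookup (\<alpha> :: int_seq) i"
  shows "0 \<le> Poly_Mapping.lookup \<alpha> i"
proof -
  obtain n where n: "Poly_Mapping.keys \<alpha> \<subseteq> {..<n}" by (rule keys_bounded)
  have "Poly_Mapping.lookup \<alpha> (max i n) \<le> Poly_Mapping.lookup \<alpha> i"
    using assms by (rule lift_Suc_antimono_le) simp
  thus ?thesis using lookup_beyond[OF n, of "max i n"] by simp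
qed

lemma is_partitionI:
  assumes "\<And>i. Poly_Mapping.lookup \<alpha> (Suc i) \<le> Poly_Mapping.lookup \<alpha> i"
  shows "is_partition \<alpha>"
  using assms antimono_seq_nonneg[OF assms] by (simp add: is_partition_def)

lemma is_partition_nonneg: "is_partition \<alpha> \<Longrightarrow> 0 \<le> Poly_Mapping.lookup \<alpha> i"
  by (rule antimono_seq_nonneg) (simp add: is_partition_def)

lemma is_partition_antimono: "is_partition \<alpha> \<Longrightarrow> i \<le> j \<Longrightarrow> Poly_Mapping.lookup \<alpha> j \<le> Poly_Mapping.lookup \<alpha> i"
  by (rule lift_Suc_antimono_le) (simp_all add: is_partition_def)

lemma horizontal_strip_refl: "is_partition \<alpha> \<Longrightarrow> horizontal_strip \<alpha> \<alpha>"
  by (simp add: horizontal_strip_def is_partition_def)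

lemma horizontal_strip_partition:
  assumes "horizontal_strip \<alpha> \<beta>" shows "is_partition \<alpha>" "is_partition \<beta>"
  using assms unfolding horizontal_strip_def by (blast intro: is_partitionI order_trans)+

lemma keys_subset_of_le:
  assumes "\<And>i. 0 \<le> Poly_Mapping.lookup \<alpha> i" "\<And>i. Poly_Mapping.lookup \<alpha> i \<le> Poly_Mapping.lookup (\<beta> :: int_seq) i"
  shows "Poly_Mapping.keys \<alpha> \<subseteq> Poly_Mapping.keys \<beta>"
proof
  fix i assume "i \<in> Poly_Mapping.keys \<alpha>"
  thus "i \<in> Poly_Mapping.keys \<beta>" using assms[of i] by (simp add: in_keys_iff)
qed

lemma u_seq_add_single:
  assumes "Poly_Mapping.keys \<alpha> \<subseteq> {..<n}"
  shows "u_seq (Poly_Mapping.single n r + \<alpha>) = u r * u_seq \<alpha>"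
proof -
  let ?\<beta> = "Poly_Mapping.single n r + \<alpha>"
  have u_seq_eq: "u_seq \<gamma> = (\<Prod>i<Suc n. u (Poly_Mapping.lookup \<gamma> i))"
    if "Poly_Mapping.keys \<gamma> \<subseteq> {..<Suc n}" for \<gamma>
    unfolding u_seq_def using that by (intro prod.mono_neutral_left) (auto simp: in_keys_iff u_def)
  have "Poly_Mapping.keys ?\<beta> \<subseteq> {..<Suc n}"
    using keys_add[of "Poly_Mapping.single n r" \<alpha>] assms by (fastforce split: if_splits)
  hence "u_seq ?\<beta> = (\<Prod>i<n. u (Poly_Mapping.lookup ?\<beta> i)) * u (Poly_Mapping.lookup ?\<beta> n)"
    by (simp add: u_seq_eq)
  also have "Poly_Mapping.lookup ?\<beta> n = r" using lookup_beyond[OF assms, of n] by (simp add: lookup_add)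
  also have "(\<Prod>i<n. u (Poly_Mapping.lookup ?\<beta> i)) = (\<Prod>i<n. u (Poly_Mapping.lookup \<alpha> i))"
    by (rule prod.cong) (auto simp: lookup_add lookup_single)
  also have "\<dots> = u_seq \<alpha>"
    unfolding u_seq_def using assms by (intro prod.mono_neutral_right) (auto simp: in_keys_iff u_def)
  finally show ?thesis by (simp add: mult.commute)
qed

lemma to_ring_mult_single:
  assumes "supported_below n f"
  shows "to_ring (frag_of (Poly_Mapping.single n r) * f) = u r * to_ring f"
proof -
  let ?c = "\<lambda>\<beta>. of_int (Poly_Mapping.lookup f \<beta>)"
  have "f = (\<Sum>\<beta>\<in>Poly_Mapping.keys f. ?c \<beta> * frag_of \<beta>)"
    using frag_expansion[of f] by (simp add: frag_extend_def frag_cmul_conv_mult)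
  hence "frag_of (Poly_Mapping.single n r) * f =
      (\<Sum>\<beta>\<in>Poly_Mapping.keys f. ?c \<beta> * frag_of (Poly_Mapping.single n r + \<beta>))"
    by (metis (no_types, lifting) sum.cong sum_distrib_left frag_of_add mult.left_commute)
  hence "to_ring (frag_of (Poly_Mapping.single n r) * f) =
      (\<Sum>\<beta>\<in>Poly_Mapping.keys f. ?c \<beta> * u_seq (Poly_Mapping.single n r + \<beta>))"
    by (simp add: frag_extend_sum to_ring_of_int o_def)
  also have "\<dots> = (\<Sum>\<beta>\<in>Poly_Mapping.keys f. ?c \<beta> * (u r * u_seq \<beta>))"
    using assms by (intro sum.cong refl) (simp add: supported_below_def u_seq_add_single)
  also have "\<dots> = u r * to_ring f"
    by (simp add: frag_extend_def frag_cmul_conv_mult sum_distrib_left mult.left_commute)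
  finally show ?thesis .
qed

text \<open>
  The exponent reached from \<open>\<mu>\<close> with \<open>p\<close> appended as entry \<open>n\<close> when the factor
  \<open>x\<^sub>i / x\<^sub>n\<close> is used \<open>g i\<close> times.
\<close>

definition spread :: "nat \<Rightarrow> int_seq \<Rightarrow> nat \<Rightarrow> (nat \<Rightarrow> nat) \<Rightarrow> int_seq" where
  "spread n \<mu> p g = Poly_Mapping.single n (int p) + \<mu> +
     (\<Sum>i<n. Poly_Mapping.single i (int (g i)) - Poly_Mapping.single n (int (g i)))"

lemma lookup_spread:
  assumes "Poly_Mapping.keys \<mu> \<subseteq> {..<n}"
  shows "Poly_Mapping.lookup (spread n \<mu> p g) i =
    (if i < n then Poly_Mapping.lookup \<mu> i + int (g i) else if i = n then int p - (\<Sum>j<n. int (g j)) else 0)"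
proof -
  have "Poly_Mapping.lookup (\<Sum>i<n. Poly_Mapping.single n (int (g i))) i = (if i = n then (\<Sum>j<n. int (g j)) else 0)"
    by (simp add: lookup_sum lookup_single when_def)
  thus ?thesis using lookup_beyond[OF assms, of i]
    by (simp add: spread_def lookup_add sum_subtractf lookup_minus lookup_sum_single lookup_single when_def)
qed

lemma keys_spread:
  assumes "Poly_Mapping.keys \<mu> \<subseteq> {..<n}"
  shows "Poly_Mapping.keys (spread n \<mu> p g) \<subseteq> {..<Suc n}"
proof
  fix i assume "i \<in> Poly_Mapping.keys (spread n \<mu> p g)"
  hence "Poly_Mapping.lookup (spread n \<mu> p g) i \<noteq> 0" by (simp add: in_keys_iff)
  thus "i \<in> {..<Suc n}" by (metis lookup_spread[OF assms] lessThan_iff less_Suc_eq)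
qed

text \<open>
  Multiplication by \<open>u\<^sub>p\<close> appends \<open>p\<close> as a new last entry, but the raising product for \<open>n + 1\<close>
  variables has the additional factors \<open>1 - t\<^sub>i\<close> with \<open>t\<^sub>i = x\<^sub>i / x\<^sub>n\<close>. They are supplied by writing
  \<open>1\<close> as \<open>(1 - t\<^sub>i) (1 + t\<^sub>i + ... + t\<^sub>i\<^sup>p)\<close>, up to terms that are sent to zero.
\<close>

lemma u_mult_schur_poly:
  assumes \<mu>: "Poly_Mapping.keys \<mu> \<subseteq> {..<n}"
  shows "u (int p) * schur_poly \<mu> = (\<Sum>g\<in>{..<n} \<rightarrow>\<^sub>E {..p}. schur_poly (spread n \<mu> p g))"
proof -
  let ?t = "\<lambda>i. frag_of (unit_seq i - unit_seq n)" and ?x = "frag_of (Poly_Mapping.single n (int p))"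
  have "u (int p) * schur_poly \<mu> = to_ring (?x * (frag_of \<mu> * raising_product n))"
    using \<mu> by (simp add: schur_poly_eq_to_ring to_ring_mult_single supported_below_mult
        supported_below_raising_product supported_below_def[of n "frag_of \<mu>"])
  also have "\<dots> = to_ring (frag_of (Poly_Mapping.single n (int p) + \<mu>) * raising_product n)"
    by (simp add: frag_of_add mult.assoc)
  also have "\<dots> = to_ring (frag_of (Poly_Mapping.single n (int p) + \<mu>) * raising_product n *
      (\<Prod>i<n. 1 - ?t i ^ Suc p))"
    using lookup_beyond[OF \<mu>, of n]
    by (intro to_ring_mult_prod[symmetric] exponents_less_raising_product) (simp_all add: lookup_add)
  also have "(\<Prod>i<n. 1 - ?t i ^ Suc p) = (\<Prod>i<n. 1 - ?t i) * (\<Prod>i<n. \<Sum>a\<le>p. ?t i ^ a)"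
    by (simp only: sum_gp_basic[symmetric] prod.distrib)
  also have "(\<Prod>i<n. \<Sum>a\<le>p. ?t i ^ a) = (\<Sum>g\<in>{..<n} \<rightarrow>\<^sub>E {..p}. \<Prod>i<n. ?t i ^ g i)"
    by (rule prod_sum_PiE) auto
  also have "frag_of (Poly_Mapping.single n (int p) + \<mu>) * raising_product n *
      ((\<Prod>i<n. 1 - ?t i) * (\<Sum>g\<in>{..<n} \<rightarrow>\<^sub>E {..p}. \<Prod>i<n. ?t i ^ g i)) =
      (\<Sum>g\<in>{..<n} \<rightarrow>\<^sub>E {..p}. frag_of (spread n \<mu> p g) * raising_product (Suc n))"
    unfolding sum_distrib_left spread_def frag_of_add frag_of_sum frag_of_single_diff_power
        raising_product_Suc by (intro sum.cong refl) (simp only: mult_ac)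
  also have "to_ring \<dots> = (\<Sum>g\<in>{..<n} \<rightarrow>\<^sub>E {..p}. to_ring (frag_of (spread n \<mu> p g) * raising_product (Suc n)))"
    by (simp add: frag_extend_sum finite_PiE o_def)
  also have "\<dots> = (\<Sum>g\<in>{..<n} \<rightarrow>\<^sub>E {..p}. schur_poly (spread n \<mu> p g))"
    using schur_poly_eq_to_ring[OF keys_spread[OF \<mu>]] by simp
  finally show ?thesis .
qed

lemma schur_poly_last_neg:
  assumes "Poly_Mapping.keys \<alpha> \<subseteq> {..<Suc n}" "Poly_Mapping.lookup \<alpha> n < 0"
  shows "schur_poly \<alpha> = 0"
proof -
  have "exponents_less n 0 (frag_of \<alpha> * raising_product n * (\<Prod>i<n. 1 - frag_of (unit_seq i - unit_seq n) ^ 1))"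
    using assms(2) by (intro exponents_less_mult_prod exponents_less_raising_product) auto
  hence "to_ring (frag_of \<alpha> * raising_product (Suc n)) = 0"
    by (intro to_ring_eq_0[of n]) (simp add: raising_product_Suc mult.assoc)
  thus ?thesis by (simp add: schur_poly_eq_to_ring[OF assms(1)])
qed

lemma sum_eq_0_of_sign_reversing:
  fixes f :: "'a \<Rightarrow> 'b::{idom, ring_char_0}"
  assumes "\<And>x. x \<in> B \<Longrightarrow> h x \<in> B" "\<And>x. x \<in> B \<Longrightarrow> h (h x) = x" "\<And>x. x \<in> B \<Longrightarrow> f (h x) = - f x"
  shows "sum f B = 0"
proof -
  have "sum f B = (\<Sum>x\<in>B. - f x)"
    by (rule sum.reindex_bij_witness[of _ h h]) (use assms in auto)
  hence "2 * sum f B = 0" by (simp add: sum_negf)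
  thus ?thesis by simp
qed

text \<open>
  All ways of adding \<open>p\<close> boxes to the first \<open>n + 1\<close> rows, whether or not the result is a partition.
\<close>

definition row_extensions :: "nat \<Rightarrow> int_seq \<Rightarrow> int \<Rightarrow> int_seq set" where
  "row_extensions n \<mu> p = {\<alpha>. Poly_Mapping.keys \<alpha> \<subseteq> {..<Suc n} \<and> total \<alpha> = total \<mu> + p \<and>
     (\<forall>i. Poly_Mapping.lookup \<mu> i \<le> Poly_Mapping.lookup \<alpha> i)}"

lemma pieri_row_extensions:
  assumes \<mu>: "Poly_Mapping.keys \<mu> \<subseteq> {..<n}" and nonneg: "\<And>i. 0 \<le> Poly_Mapping.lookup \<mu> i"
  shows "u (int p) * schur_poly \<mu> = (\<Sum>\<alpha>\<in>row_extensions n \<mu> (int p). schur_poly \<alpha>)"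
    and "finite (row_extensions n \<mu> (int p))"
proof -
  let ?G = "{..<n} \<rightarrow>\<^sub>E {..p}"
  let ?G' = "{g \<in> ?G. (\<Sum>i<n. g i) \<le> p}"
  let ?inc = "\<lambda>\<alpha>. restrict (\<lambda>i. nat (Poly_Mapping.lookup \<alpha> i - Poly_Mapping.lookup \<mu> i)) {..<n}"
  have finG: "finite ?G" by (simp add: finite_PiE)
  note keys = keys_spread[OF \<mu>]
  have inc: "?inc \<alpha> \<in> ?G'" "spread n \<mu> p (?inc \<alpha>) = \<alpha>" if "\<alpha> \<in> row_extensions n \<mu> (int p)" for \<alpha>
  proof -
    have k: "Poly_Mapping.keys \<alpha> \<subseteq> {..<Suc n}" and t: "total \<alpha> = total \<mu> + int p"
      and le: "\<And>i. Poly_Mapping.lookup \<mu> i \<le> Poly_Mapping.lookup \<alpha> i"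
      using that by (auto simp: row_extensions_def)
    have sum: "(\<Sum>i<n. int (?inc \<alpha> i)) = int p - Poly_Mapping.lookup \<alpha> n"
    proof -
      have "(\<Sum>i<n. int (?inc \<alpha> i)) = (\<Sum>i<n. Poly_Mapping.lookup \<alpha> i - Poly_Mapping.lookup \<mu> i)"
        using le by (intro sum.cong) auto
      thus ?thesis using t by (simp add: total_eq_sum[OF k] total_eq_sum[OF \<mu>] sum_subtractf)
    qed
    moreover have "0 \<le> Poly_Mapping.lookup \<alpha> n" using le[of n] nonneg[of n] by simp
    ultimately have "int (\<Sum>i<n. ?inc \<alpha> i) \<le> int p" by (simp del: restrict_apply)
    hence sum': "(\<Sum>i<n. ?inc \<alpha> i) \<le> p" by (simp only: of_nat_le_iff)
    have "?inc \<alpha> i \<le> p" if "i < n" for i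
      using member_le_sum[of i "{..<n}" "?inc \<alpha>"] sum' that by simp
    thus "?inc \<alpha> \<in> ?G'" using sum' by auto
    show "spread n \<mu> p (?inc \<alpha>) = \<alpha>"
      using sum le lookup_beyond[OF k] by (intro poly_mapping_eqI) (auto simp: lookup_spread[OF \<mu>])
  qed
  show "finite (row_extensions n \<mu> (int p))"
  proof (rule finite_subset)
    show "row_extensions n \<mu> (int p) \<subseteq> spread n \<mu> p ` ?G"
    proof
      fix \<alpha> assume "\<alpha> \<in> row_extensions n \<mu> (int p)"
      thus "\<alpha> \<in> spread n \<mu> p ` ?G" using inc by (metis (no_types, lifting) imageI mem_Collect_eq)
    qed
  qed (use finG in simp)
  have "u (int p) * schur_poly \<mu> = (\<Sum>g\<in>?G. schur_poly (spread n \<mu> p g))"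
    by (rule u_mult_schur_poly[OF \<mu>])
  also have "\<dots> = (\<Sum>g\<in>?G'. schur_poly (spread n \<mu> p g))"
  proof (rule sum.mono_neutral_right[OF finG])
    show "\<forall>g\<in>?G - ?G'. schur_poly (spread n \<mu> p g) = 0"
    proof
      fix g assume "g \<in> ?G - ?G'"
      hence "p < (\<Sum>i<n. g i)" by (metis (no_types, lifting) DiffE mem_Collect_eq not_le)
      hence "int p < (\<Sum>i<n. int (g i))" by (metis of_nat_less_iff of_nat_sum)
      thus "schur_poly (spread n \<mu> p g) = 0"
        by (intro schur_poly_last_neg[OF keys]) (simp add: lookup_spread[OF \<mu>])
    qed
  qed auto
  also have "\<dots> = (\<Sum>\<alpha>\<in>row_extensions n \<mu> (int p). schur_poly \<alpha>)"
  proof (rule sum.reindex_bij_witness[of _ ?inc "spread n \<mu> p"])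
    fix g assume g: "g \<in> ?G'"
    show "?inc (spread n \<mu> p g) = g"
    proof
      fix i
      have "g i = undefined" if "\<not> i < n" by (rule PiE_arb[of g "{..<n}" "\<lambda>_. {..p}"]) (use g that in simp_all)
      thus "?inc (spread n \<mu> p g) i = g i" by (simp add: lookup_spread[OF \<mu>])
    qed
    have "(\<Sum>i<n. g i) \<le> p" using g by blast
    hence "(\<Sum>i<n. int (g i)) \<le> int p" by (metis of_nat_le_iff of_nat_sum)
    moreover have "total (spread n \<mu> p g) = total \<mu> + int p"
      by (simp add: total_eq_sum[OF keys] total_eq_sum[OF \<mu>] lookup_spread[OF \<mu>] sum.distrib)
    ultimately show "spread n \<mu> p g \<in> row_extensions n \<mu> (int p)"
      using keys lookup_beyond[OF \<mu>] by (simp add: row_extensions_def lookup_spread[OF \<mu>])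
  qed (use inc in auto)
  finally show "u (int p) * schur_poly \<mu> = (\<Sum>\<alpha>\<in>row_extensions n \<mu> (int p). schur_poly \<alpha>)" .
qed

lemma total_dot_action:
  assumes "Poly_Mapping.keys \<alpha> \<subseteq> {..<n}" "Suc k < n"
  shows "total (dot_action n (transpose k (Suc k)) \<alpha>) = total \<alpha>"
proof -
  let ?\<tau> = "transpose k (Suc k)"
  have \<tau>: "?\<tau> permutes {..<n}" using assms(2) by (rule transpose_permutes)
  have "(\<Sum>i<n. Poly_Mapping.lookup \<alpha> (?\<tau> i) - int (?\<tau> i)) = (\<Sum>i<n. Poly_Mapping.lookup \<alpha> i - int i)"
    using sum.permute[OF \<tau>, of "\<lambda>i. Poly_Mapping.lookup \<alpha> i - int i"] by (simp add: o_def)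
  thus ?thesis
    by (simp add: total_eq_sum[OF assms(1)] total_eq_sum[OF keys_dot_action[OF \<tau> assms(1)]] lookup_dot_action[OF \<tau>]
        sum.distrib sum_subtractf)
qed

text \<open>
  A sequence \<open>\<alpha>\<close> obtained by adding boxes is not a horizontal strip if \<open>\<alpha>\<^sub>i\<^sub>+\<^sub>1 > \<mu>\<^sub>i\<close> for some \<open>i\<close>. For
  the largest such \<open>i\<close> the dot transposition of positions \<open>i\<close> and \<open>i + 1\<close> keeps \<open>\<alpha>\<close> above \<open>\<mu>\<close> and preserves the
  inequality, and no inequality for a larger index is affected. So these \<open>\<alpha>\<close> cancel in pairs.
\<close>

theorem pieri:
  assumes part: "is_partition \<mu>"
  shows "u p * schur_poly \<mu> = (\<Sum>\<alpha> | horizontal_strip \<mu> \<alpha> \<and> total \<alpha> = total \<mu> + p. schur_poly \<alpha>)"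
    and "finite {\<alpha>. horizontal_strip \<mu> \<alpha> \<and> total \<alpha> = total \<mu> + p}"
proof -
  obtain n where \<mu>: "Poly_Mapping.keys \<mu> \<subseteq> {..<n}" by (rule keys_bounded)
  let ?S = "{\<alpha>. horizontal_strip \<mu> \<alpha> \<and> total \<alpha> = total \<mu> + p}"
  let ?E = "row_extensions n \<mu> p"
  define bad where "bad \<alpha> i \<longleftrightarrow> Poly_Mapping.lookup \<mu> i < Poly_Mapping.lookup \<alpha> (Suc i)" for \<alpha> :: int_seq and i
  have S: "?S = {\<alpha> \<in> ?E. \<forall>i. \<not> bad \<alpha> i}"
  proof -
    have "Poly_Mapping.keys \<alpha> \<subseteq> {..<Suc n}" if "horizontal_strip \<mu> \<alpha>" for \<alpha>
    proof
      fix i assume i: "i \<in> Poly_Mapping.keys \<alpha>"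
      show "i \<in> {..<Suc n}"
      proof (rule ccontr)
        assume "i \<notin> {..<Suc n}"
        then obtain j where j: "i = Suc j" "n \<le> j" by (cases i) auto
        hence "Poly_Mapping.lookup \<alpha> i \<le> 0"
          using that lookup_beyond[OF \<mu>, of j] unfolding horizontal_strip_def by metis
        moreover have "0 \<le> Poly_Mapping.lookup \<alpha> i"
          using horizontal_strip_partition[OF that] is_partition_nonneg by blast
        ultimately show False using i by (simp add: in_keys_iff)
      qed
    qed
    thus ?thesis by (auto simp: row_extensions_def horizontal_strip_def bad_def not_less)
  qed
  have "u p * schur_poly \<mu> = (\<Sum>\<alpha>\<in>?S. schur_poly \<alpha>) \<and> finite ?S"
  proof (cases "p < 0")
    case True
    have "total \<mu> \<le> total \<alpha>" if "\<alpha> \<in> ?E" for \<alpha>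
    proof -
      have k: "Poly_Mapping.keys \<alpha> \<subseteq> {..<Suc n}" "Poly_Mapping.keys \<mu> \<subseteq> {..<Suc n}"
        using that \<mu> by (auto simp: row_extensions_def)
      show ?thesis unfolding total_eq_sum[OF k(1)] total_eq_sum[OF k(2)]
        using that by (intro sum_mono) (auto simp: row_extensions_def)
    qed
    hence "?E = {}" using True by (auto simp: row_extensions_def)
    thus ?thesis unfolding S using True by (simp add: u_def)
  next
    case False
    then obtain q where q: "p = int q" using nonneg_int_cases by (metis not_less)
    let ?B = "{\<alpha> \<in> ?E. \<exists>i. bad \<alpha> i}"
    define k where "k \<alpha> = (GREATEST i. bad \<alpha> i)" for \<alpha>
    define h where "h \<alpha> = dot_action (Suc n) (transpose (k \<alpha>) (Suc (k \<alpha>))) \<alpha>" for \<alpha>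
    have fin: "finite ?E" and E: "u p * schur_poly \<mu> = (\<Sum>\<alpha>\<in>?E. schur_poly \<alpha>)"
      using pieri_row_extensions[OF \<mu>, of q] is_partition_nonneg[OF part] by (simp_all add: q)
    have step: "h \<alpha> \<in> ?B \<and> h (h \<alpha>) = \<alpha> \<and> schur_poly (h \<alpha>) = - schur_poly \<alpha>" if "\<alpha> \<in> ?B" for \<alpha>
    proof -
      let ?\<tau> = "transpose (k \<alpha>) (Suc (k \<alpha>))"
      have \<alpha>: "Poly_Mapping.keys \<alpha> \<subseteq> {..<Suc n}" and t: "total \<alpha> = total \<mu> + p"
        and le: "\<And>i. Poly_Mapping.lookup \<mu> i \<le> Poly_Mapping.lookup \<alpha> i" and "\<exists>i. bad \<alpha> i"
        using that by (auto simp: row_extensions_def)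
      have bound: "i < n" if "bad \<alpha> i" for i
        using that lookup_beyond[OF \<alpha>, of "Suc i"] is_partition_nonneg[OF part, of i]
        unfolding bad_def by (metis not_le not_less_eq_eq)
      have bad_k: "bad \<alpha> (k \<alpha>)"
        unfolding k_def using \<open>\<exists>i. bad \<alpha> i\<close> by (rule GreatestI_ex_nat) (use bound in \<open>blast intro: less_imp_le\<close>)
      have max_k: "i \<le> k \<alpha>" if "bad \<alpha> i" for i
        unfolding k_def using that by (rule Greatest_le_nat) (use bound in \<open>blast intro: less_imp_le\<close>)
      have kn: "Suc (k \<alpha>) < Suc n" using bound[OF bad_k] by simp
      note \<tau> = transpose_permutes[OF kn]
      have l: "Poly_Mapping.lookup (h \<alpha>) i = (if i = k \<alpha> then Poly_Mapping.lookup \<alpha> (Suc (k \<alpha>)) - 1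
          else if i = Suc (k \<alpha>) then Poly_Mapping.lookup \<alpha> (k \<alpha>) + 1 else Poly_Mapping.lookup \<alpha> i)" for i
        unfolding h_def lookup_dot_action[OF \<tau>] by (auto simp: transpose_def)
      have mono: "Poly_Mapping.lookup \<mu> (Suc (k \<alpha>)) \<le> Poly_Mapping.lookup \<mu> (k \<alpha>)"
        using part by (simp add: is_partition_def)
      have bad_h: "bad (h \<alpha>) (k \<alpha>)" using le[of "k \<alpha>"] by (simp add: bad_def l)
      moreover have "i \<le> k \<alpha>" if "bad (h \<alpha>) i" for i
        using max_k[of i] that by (auto simp: bad_def l split: if_splits)
      ultimately have kh: "k (h \<alpha>) = k \<alpha>" unfolding k_def[of "h \<alpha>"] by (intro Greatest_equality)
      have "h \<alpha> \<in> ?E"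
        using keys_dot_action[OF \<tau> \<alpha>] total_dot_action[OF \<alpha> kn] t le mono order_trans[OF mono le[of "k \<alpha>"]] bad_k
        by (auto simp: row_extensions_def h_def[symmetric] l bad_def)
      moreover have "h (h \<alpha>) = \<alpha>"
        unfolding h_def[of "h \<alpha>"] kh unfolding h_def dot_action_compose[OF \<tau> \<tau>]
        by (rule poly_mapping_eqI) (simp add: lookup_dot_action[OF permutes_id, unfolded id_def] o_def)
      moreover have "schur_poly (h \<alpha>) = - schur_poly \<alpha>"
        unfolding h_def using \<alpha> kn by (rule schur_poly_dot_action)
      ultimately show ?thesis using bad_h by blast
    qed
    have "(\<Sum>\<alpha>\<in>?B. schur_poly \<alpha>) = 0"
      by (rule sum_eq_0_of_sign_reversing[of _ h]) (use step in blast)+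
    moreover have "?E = ?S \<union> ?B" unfolding S by blast
    moreover have "?S \<inter> ?B = {}" unfolding S by blast
    ultimately have "(\<Sum>\<alpha>\<in>?E. schur_poly \<alpha>) = (\<Sum>\<alpha>\<in>?S. schur_poly \<alpha>)"
      using fin by (metis (no_types, lifting) finite_Un sum.union_disjoint add.right_neutral)
    thus ?thesis using E fin \<open>?E = ?S \<union> ?B\<close> by (metis (no_types, lifting) finite_Un)
  qed
  thus "u p * schur_poly \<mu> = (\<Sum>\<alpha>\<in>?S. schur_poly \<alpha>)" "finite ?S" by blast+
qed


section \<open>Linear independence of the Schur polynomials of partitions\<close>

definition nonzero_parts :: "int_seq \<Rightarrow> int multiset" where
  "nonzero_parts \<alpha> = image_mset (Poly_Mapping.lookup \<alpha>) (mset_set (Poly_Mapping.keys \<alpha>))"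

lemma u_seq_single:
  assumes "\<And>i. 0 \<le> Poly_Mapping.lookup \<alpha> i"
  shows "u_seq \<alpha> = frag_of (\<Sum>i\<in>Poly_Mapping.keys \<alpha>. Poly_Mapping.single (nat (Poly_Mapping.lookup \<alpha> i) - 1) 1)"
proof -
  have "0 < Poly_Mapping.lookup \<alpha> i" if "i \<in> Poly_Mapping.keys \<alpha>" for i
    using assms[of i] that by (simp add: in_keys_iff)
  moreover have "u r = frag_of (Poly_Mapping.single (nat r - 1) 1)" if "0 < r" for r
    using that by (simp add: u_def)
  ultimately show ?thesis unfolding u_seq_def frag_of_sum by (intro prod.cong refl) blast
qed

lemma parts_eq_if_u_seq_eq:
  assumes "\<And>i. 0 \<le> Poly_Mapping.lookup \<alpha> i" "\<And>i. 0 \<le> Poly_Mapping.lookup \<beta> i" "u_seq \<alpha> = u_seq \<beta>"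
  shows "nonzero_parts \<alpha> = nonzero_parts \<beta>"
proof (rule multiset_eqI)
  fix x :: int
  let ?m = "\<lambda>\<alpha>. \<Sum>i\<in>Poly_Mapping.keys \<alpha>. Poly_Mapping.single (nat (Poly_Mapping.lookup \<alpha> i) - 1) (1::nat)"
  have cnt: "count (nonzero_parts \<alpha>) x = Poly_Mapping.lookup (?m \<alpha>) (nat x - 1)"
    if nonneg: "\<And>i. 0 \<le> Poly_Mapping.lookup \<alpha> i" and "0 < x" for \<alpha> :: int_seq
  proof -
    have "Poly_Mapping.lookup (?m \<alpha>) (nat x - 1) =
        (\<Sum>i\<in>Poly_Mapping.keys \<alpha>. if Poly_Mapping.lookup \<alpha> i = x then 1 else 0)"
      unfolding lookup_sum
    proof (rule sum.cong[OF refl])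
      fix i assume "i \<in> Poly_Mapping.keys \<alpha>"
      hence "0 < Poly_Mapping.lookup \<alpha> i" using nonneg[of i] by (simp add: in_keys_iff)
      thus "Poly_Mapping.lookup (Poly_Mapping.single (nat (Poly_Mapping.lookup \<alpha> i) - 1) 1) (nat x - 1) =
          (if Poly_Mapping.lookup \<alpha> i = x then 1 else (0::nat))"
        using \<open>0 < x\<close> by (auto simp: lookup_single when_def)
    qed
    also have "\<dots> = card {i \<in> Poly_Mapping.keys \<alpha>. Poly_Mapping.lookup \<alpha> i = x}"
      by (simp add: sum.If_cases Int_def)
    also have "\<dots> = count (nonzero_parts \<alpha>) x"
      unfolding nonzero_parts_def count_image_mset' by (simp add: Int_def) (rule arg_cong[where f = card], auto)
    finally show ?thesis by simp
  qed
  show "count (nonzero_parts \<alpha>) x = count (nonzero_parts \<beta>) x"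
  proof (cases "0 < x")
    case True
    have "?m \<alpha> = ?m \<beta>" using assms(3) by (simp add: u_seq_single assms(1,2) frag_of_eq)
    thus ?thesis using cnt[OF assms(1) True] cnt[OF assms(2) True] by simp
  next
    case False
    have "x \<notin># nonzero_parts \<gamma>" if "\<And>i. 0 \<le> Poly_Mapping.lookup \<gamma> i" for \<gamma>
    proof
      assume "x \<in># nonzero_parts \<gamma>"
      then obtain i where "i \<in> Poly_Mapping.keys \<gamma>" "x = Poly_Mapping.lookup \<gamma> i" by (auto simp: nonzero_parts_def)
      thus False using that[of i] False by (simp add: in_keys_iff)
    qed
    thus ?thesis using assms(1,2) by (metis not_in_iff)
  qed
qed

text \<open>
  A partition is recovered from its multiset of parts: \<open>r < \<alpha>\<^sub>i\<close> iff more than \<open>i\<close> parts exceed \<open>r\<close>.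
\<close>

lemma partition_eq_if_parts_eq:
  assumes "is_partition \<alpha>" "is_partition \<beta>" "nonzero_parts \<alpha> = nonzero_parts \<beta>"
  shows "\<alpha> = \<beta>"
proof -
  have char: "r < Poly_Mapping.lookup \<alpha> i \<longleftrightarrow> i < size (filter_mset (\<lambda>x. r < x) (nonzero_parts \<alpha>))"
    if part: "is_partition \<alpha>" and r: "0 \<le> r" for \<alpha> i r
  proof -
    let ?A = "{j. r < Poly_Mapping.lookup \<alpha> j}"
    have "?A \<subseteq> Poly_Mapping.keys \<alpha>" using r by (auto simp: in_keys_iff)
    hence fin: "finite ?A" and A: "{j \<in> Poly_Mapping.keys \<alpha>. r < Poly_Mapping.lookup \<alpha> j} = ?A"
      by (auto intro: finite_subset)
    have sz: "size (filter_mset (\<lambda>x. r < x) (nonzero_parts \<alpha>)) = card ?A"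
      by (simp add: nonzero_parts_def filter_mset_image_mset filter_mset_mset_set A)
    have down: "j \<in> ?A" if "k \<in> ?A" "j \<le> k" for j k
      using that is_partition_antimono[OF part, of j k] by simp
    show ?thesis
    proof
      assume "r < Poly_Mapping.lookup \<alpha> i"
      hence "{..i} \<subseteq> ?A" using down by blast
      from card_mono[OF fin this] show "i < size (filter_mset (\<lambda>x. r < x) (nonzero_parts \<alpha>))" by (simp add: sz)
    next
      assume "i < size (filter_mset (\<lambda>x. r < x) (nonzero_parts \<alpha>))"
      show "r < Poly_Mapping.lookup \<alpha> i"
      proof (rule ccontr)
        assume "\<not> r < Poly_Mapping.lookup \<alpha> i"
        hence "?A \<subseteq> {..<i}" using down by (metis lessThan_iff mem_Collect_eq not_le subsetI)
        from card_mono[OF _ this] have "card ?A \<le> i" by simp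
        thus False using \<open>i < size _\<close> sz by simp
      qed
    qed
  qed
  show ?thesis
  proof (rule poly_mapping_eqI)
    fix i
    have *: "r < Poly_Mapping.lookup \<alpha> i \<longleftrightarrow> r < Poly_Mapping.lookup \<beta> i" if "0 \<le> r" for r
      using char[OF assms(1) that] char[OF assms(2) that] assms(3) by simp
    show "Poly_Mapping.lookup \<alpha> i = Poly_Mapping.lookup \<beta> i"
      using *[of "Poly_Mapping.lookup \<alpha> i"] *[of "Poly_Mapping.lookup \<beta> i"]
        is_partition_nonneg[OF assms(1), of i] is_partition_nonneg[OF assms(2), of i] by linarith
  qed
qed

definition square_sum :: "int_seq \<Rightarrow> int" where
  "square_sum \<alpha> = (\<Sum>i\<in>Poly_Mapping.keys \<alpha>. (Poly_Mapping.lookup \<alpha> i)\<^sup>2)"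

lemma square_sum_parts: "square_sum \<alpha> = (\<Sum>x\<in>#nonzero_parts \<alpha>. x\<^sup>2)"
  by (simp add: square_sum_def nonzero_parts_def image_mset.compositionality o_def sum_unfold_sum_mset)

lemma square_sum_eq:
  "Poly_Mapping.keys \<alpha> \<subseteq> {..<n} \<Longrightarrow> square_sum \<alpha> = (\<Sum>i<n. (Poly_Mapping.lookup \<alpha> i)\<^sup>2)"
  unfolding square_sum_def by (rule sum.mono_neutral_left) (auto simp: in_keys_iff)

lemma sum_mult_raising:
  fixes c :: "nat \<Rightarrow> int"
  assumes S: "finite S" "S \<subseteq> {(i, j). i < j}" and n: "\<And>i j. (i, j) \<in> S \<Longrightarrow> j < n"
  shows "(\<Sum>k<n. c k * Poly_Mapping.lookup (\<Sum>(i, j)\<in>S. unit_seq i - unit_seq j) k) = (\<Sum>(i, j)\<in>S. c i - c j)"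
proof -
  have "(\<Sum>k<n. c k * Poly_Mapping.lookup (\<Sum>(i, j)\<in>S. unit_seq i - unit_seq j) k) =
      (\<Sum>p\<in>S. \<Sum>k<n. c k * Poly_Mapping.lookup (case p of (i, j) \<Rightarrow> unit_seq i - unit_seq j) k)"
    unfolding lookup_sum sum_distrib_left by (rule sum.swap)
  also have "\<dots> = (\<Sum>(i, j)\<in>S. c i - c j)"
  proof (rule sum.cong[OF refl], clarify)
    fix i j assume "(i, j) \<in> S"
    hence ij: "i < n" "j < n" using n S(2) by fastforce+
    have "(\<Sum>k<n. c k * Poly_Mapping.lookup (unit_seq i - unit_seq j) k) =
        (\<Sum>k<n. if k = i then c i else 0) - (\<Sum>k<n. if k = j then c j else 0)"
      unfolding sum_subtractf[symmetric]
      by (rule sum.cong) (auto simp: lookup_minus lookup_single when_def)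
    also have "\<dots> = c i - c j" using ij by simp
    finally show "(\<Sum>k<n. c k * Poly_Mapping.lookup (unit_seq i - unit_seq j) k) = c i - c j" .
  qed
  finally show ?thesis .
qed

text \<open>
  The sum of squares is symmetric in the entries and strictly increases under raising operators applied to a
  partition: these add a vector \<open>v \<noteq> 0\<close>, a sum of differences \<open>e\<^sub>i - e\<^sub>j\<close> with \<open>i < j\<close>, whose inner product with
  the weakly decreasing \<open>\<alpha>\<close> is nonnegative. So the sum of squares orders the monomials so that \<open>u\<^sub>\<alpha>\<close> is the unique least term of \<open>U\<^sub>\<alpha>\<close>.
\<close>

lemma square_sum_raising:
  assumes part: "is_partition \<alpha>" and S: "finite S" "S \<subseteq> {(i, j). i < j}" "S \<noteq> {}"
  shows "square_sum \<alpha> < square_sum (raising_monomial S \<alpha>)"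
proof -
  let ?v = "\<Sum>(i, j)\<in>S. unit_seq i - unit_seq j"
  obtain m where m: "Poly_Mapping.keys \<alpha> \<union> Poly_Mapping.keys (raising_monomial S \<alpha>) \<union> Poly_Mapping.keys ?v \<union> snd ` S \<subseteq> {..<m}"
    using finite_nat_set_iff_bounded[of "Poly_Mapping.keys \<alpha> \<union> Poly_Mapping.keys (raising_monomial S \<alpha>) \<union> Poly_Mapping.keys ?v \<union> snd ` S"] S(1)
    by auto
  have jm: "j < m" if "(i, j) \<in> S" for i j using m that by force
  have "(\<Sum>k<m. int k * Poly_Mapping.lookup ?v k) = (\<Sum>(i, j)\<in>S. int i - int j)"
    by (rule sum_mult_raising[OF S(1,2) jm])
  also have "\<dots> < (\<Sum>(i, j)\<in>S. 0)"
    using S by (intro sum_strict_mono) auto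
  finally have "\<exists>k<m. Poly_Mapping.lookup ?v k \<noteq> 0"
    by (metis (no_types, lifting) case_prod_beta lessThan_iff less_irrefl mult_zero_right sum.neutral)
  then obtain k where k: "k < m" "Poly_Mapping.lookup ?v k \<noteq> 0" by blast
  have "0 < (Poly_Mapping.lookup ?v k)\<^sup>2" using k(2) by simp
  also have "\<dots> \<le> (\<Sum>k<m. (Poly_Mapping.lookup ?v k)\<^sup>2)"
    using k(1) by (intro member_le_sum) auto
  finally have pos: "0 < (\<Sum>k<m. (Poly_Mapping.lookup ?v k)\<^sup>2)" .
  have "(\<Sum>k<m. Poly_Mapping.lookup \<alpha> k * Poly_Mapping.lookup ?v k) =
      (\<Sum>(i, j)\<in>S. Poly_Mapping.lookup \<alpha> i - Poly_Mapping.lookup \<alpha> j)"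
    by (rule sum_mult_raising[OF S(1,2) jm])
  also have "\<dots> \<ge> 0"
  proof (intro sum_nonneg, clarify)
    fix i j assume "(i, j) \<in> S"
    hence "i \<le> j" using S(2) by auto
    thus "0 \<le> Poly_Mapping.lookup \<alpha> i - Poly_Mapping.lookup \<alpha> j"
      using is_partition_antimono[OF part] by simp
  qed
  finally have inner: "0 \<le> (\<Sum>k<m. Poly_Mapping.lookup \<alpha> k * Poly_Mapping.lookup ?v k)" .
  have "square_sum (raising_monomial S \<alpha>) = (\<Sum>k<m. (Poly_Mapping.lookup \<alpha> k + Poly_Mapping.lookup ?v k)\<^sup>2)"
    using m by (subst square_sum_eq[of _ m]) (simp_all add: raising_monomial_def lookup_add)
  also have "\<dots> = (\<Sum>k<m. (Poly_Mapping.lookup \<alpha> k)\<^sup>2) + (\<Sum>k<m. (Poly_Mapping.lookup ?v k)\<^sup>2) +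
      2 * (\<Sum>k<m. Poly_Mapping.lookup \<alpha> k * Poly_Mapping.lookup ?v k)"
    by (simp add: power2_sum sum.distrib sum_distrib_left mult.assoc)
  also have "\<dots> > (\<Sum>k<m. (Poly_Mapping.lookup \<alpha> k)\<^sup>2)" using pos inner by simp
  also have "(\<Sum>k<m. (Poly_Mapping.lookup \<alpha> k)\<^sup>2) = square_sum \<alpha>"
    using m by (intro square_sum_eq[symmetric]) simp
  finally show ?thesis .
qed

lemma u_seq_neq_0_iff: "u_seq \<alpha> \<noteq> 0 \<longleftrightarrow> (\<forall>i. 0 \<le> Poly_Mapping.lookup \<alpha> i)"
  using u_seq_neg u_seq_single frag_of_nonzero by (metis not_le)

lemma lookup_u_seq:
  assumes "is_partition \<kappa>" "u_seq \<kappa> = frag_of M"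
  shows "Poly_Mapping.lookup (u_seq \<alpha>) M =
    (if (\<forall>i. 0 \<le> Poly_Mapping.lookup \<alpha> i) \<and> nonzero_parts \<alpha> = nonzero_parts \<kappa> then 1 else 0)"
proof (cases "\<forall>i. 0 \<le> Poly_Mapping.lookup \<alpha> i")
  case True
  then obtain M' where M': "u_seq \<alpha> = frag_of M'" using u_seq_single by metis
  have "nonzero_parts \<alpha> = nonzero_parts \<kappa>" if "M = M'"
    using that M' assms True is_partition_nonneg by (intro parts_eq_if_u_seq_eq) auto
  moreover have "M = M'" if "nonzero_parts \<alpha> = nonzero_parts \<kappa>"
  proof -
    have u: "u_seq \<gamma> = (\<Prod>x\<in>#nonzero_parts \<gamma>. u x)" for \<gamma>
      by (simp add: u_seq_def nonzero_parts_def image_mset.compositionality o_def prod_unfold_prod_mset)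
    have "u_seq \<alpha> = u_seq \<kappa>" using that by (simp add: u)
    thus ?thesis using assms M' by (simp add: frag_of_eq)
  qed
  ultimately show ?thesis using True M' by auto
next
  case False
  hence "u_seq \<alpha> = 0" using u_seq_neq_0_iff by blast
  thus ?thesis using False by simp
qed

lemma lookup_schur_poly:
  assumes \<kappa>: "is_partition \<kappa>" "u_seq \<kappa> = frag_of M" and \<alpha>: "is_partition \<alpha>" "square_sum \<kappa> \<le> square_sum \<alpha>"
  shows "Poly_Mapping.lookup (schur_poly \<alpha>) M = (if \<alpha> = \<kappa> then 1 else 0)"
proof -
  have lookup_sign: "Poly_Mapping.lookup ((-1) ^ k * f) M = (-1) ^ k * Poly_Mapping.lookup f M" for k and f :: poly_ring
    using lookup_frag_cmul[of "(-1) ^ k" f M] by (simp add: frag_cmul_conv_mult)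
  have "Poly_Mapping.lookup (schur_poly \<alpha>) M =
      (\<Sum>S\<in>schur_index \<alpha>. (-1) ^ card S * Poly_Mapping.lookup (u_seq (raising_monomial S \<alpha>)) M)"
    by (simp add: schur_poly_def lookup_sum lookup_sign)
  also have "\<dots> = (\<Sum>S\<in>{{}}. (-1) ^ card S * Poly_Mapping.lookup (u_seq (raising_monomial S \<alpha>)) M)"
  proof (rule sum.mono_neutral_right[OF finite_schur_index])
    show "{{}} \<subseteq> schur_index \<alpha>"
      using is_partition_nonneg[OF \<alpha>(1)] by (simp add: schur_index_def raising_monomial_empty u_seq_neq_0_iff)
    show "\<forall>S\<in>schur_index \<alpha> - {{}}. (-1) ^ card S * Poly_Mapping.lookup (u_seq (raising_monomial S \<alpha>)) M = 0"
    proof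
      fix S assume "S \<in> schur_index \<alpha> - {{}}"
      hence "square_sum \<alpha> < square_sum (raising_monomial S \<alpha>)"
        using square_sum_raising[OF \<alpha>(1)] by (auto simp: schur_index_def)
      hence "nonzero_parts (raising_monomial S \<alpha>) \<noteq> nonzero_parts \<kappa>" using \<alpha>(2) by (auto simp: square_sum_parts)
      thus "(-1) ^ card S * Poly_Mapping.lookup (u_seq (raising_monomial S \<alpha>)) M = 0"
        by (simp add: lookup_u_seq[OF \<kappa>])
    qed
  qed
  also have "\<dots> = (if \<alpha> = \<kappa> then 1 else 0)"
    using is_partition_nonneg[OF \<alpha>(1)] partition_eq_if_parts_eq[OF \<alpha>(1) \<kappa>(1)]
    by (auto simp: raising_monomial_empty lookup_u_seq[OF \<kappa>])
  finally show ?thesis .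
qed

text \<open>
  A monomial \<open>u\<^sub>\<kappa>\<close> with least sum of squares among the \<open>\<kappa>\<close> in a linear relation occurs in no other
  \<open>U\<^sub>\<alpha>\<close> of the relation.
\<close>

theorem schur_poly_independent:
  assumes "Poly_Mapping.keys c \<subseteq> Collect is_partition" "frag_extend schur_poly c = 0"
  shows "c = 0"
proof (rule ccontr)
  assume "c \<noteq> 0"
  hence "Poly_Mapping.keys c \<noteq> {}" by simp
  then obtain \<kappa> where \<kappa>: "\<kappa> \<in> Poly_Mapping.keys c"
    and min: "\<And>\<alpha>. \<alpha> \<in> Poly_Mapping.keys c \<Longrightarrow> square_sum \<kappa> \<le> square_sum \<alpha>"
    using arg_min_least[OF finite_keys] arg_min_if_finite(1)[OF finite_keys] by metis
  have part: "is_partition \<kappa>" using \<kappa> assms(1) by blast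
  obtain M where M: "u_seq \<kappa> = frag_of M" using u_seq_single[OF is_partition_nonneg[OF part]] by blast
  have "Poly_Mapping.lookup (frag_extend schur_poly c) M =
      (\<Sum>\<alpha>\<in>Poly_Mapping.keys c. Poly_Mapping.lookup c \<alpha> * (if \<alpha> = \<kappa> then 1 else 0))"
    unfolding frag_extend_def lookup_sum using assms(1) min
    by (intro sum.cong) (auto simp: lookup_schur_poly[OF part M] subset_iff)
  also have "\<dots> = Poly_Mapping.lookup c \<kappa>" using \<kappa> by (simp add: if_distrib cong: if_cong)
  finally show False using \<kappa> assms(2) by (simp add: in_keys_iff)
qed

lemma schur_coeffs_eqI:
  assumes "Poly_Mapping.keys c \<subseteq> Collect is_partition" "frag_extend schur_poly c = f"
  shows "schur_coeffs f = c"
  unfolding schur_coeffs_def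
proof (rule the_equality)
  show "Poly_Mapping.keys c \<subseteq> Collect is_partition \<and>
     f = (\<Sum>\<kappa>\<in>Poly_Mapping.keys c. of_int (Poly_Mapping.lookup c \<kappa>) * schur_poly \<kappa>)"
    using assms by (simp add: frag_extend_def frag_cmul_conv_mult)
next
  fix d assume d: "Poly_Mapping.keys d \<subseteq> Collect is_partition \<and>
     f = (\<Sum>\<kappa>\<in>Poly_Mapping.keys d. of_int (Poly_Mapping.lookup d \<kappa>) * schur_poly \<kappa>)"
  hence "frag_extend schur_poly (d - c) = 0"
    using assms(2) by (simp add: frag_extend_diff) (simp add: frag_extend_def frag_cmul_conv_mult)
  moreover have "Poly_Mapping.keys (d - c) \<subseteq> Collect is_partition"
    using d assms(1) keys_diff[of d c] by blast
  ultimately have "d - c = 0" by (intro schur_poly_independent)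
  thus "d = c" by simp
qed


section \<open>Chains of horizontal strips and their cancellation\<close>

text \<open>
  The number of boxes of a diagram in the columns \<open>r\<close>, \<open>r + 1\<close>, and so on.
\<close>

definition boxes_from :: "nat \<Rightarrow> int_seq \<Rightarrow> int" where
  "boxes_from r \<alpha> = (\<Sum>i\<in>Poly_Mapping.keys \<alpha>. max (Poly_Mapping.lookup \<alpha> i - int r) 0)"

lemma boxes_from_eq_sum:
  "Poly_Mapping.keys \<alpha> \<subseteq> {..<n} \<Longrightarrow> boxes_from r \<alpha> = (\<Sum>i<n. max (Poly_Mapping.lookup \<alpha> i - int r) 0)"
  unfolding boxes_from_def by (rule sum.mono_neutral_left) (auto simp: in_keys_iff)

lemma boxes_from_0:
  assumes "is_partition \<alpha>" shows "boxes_from 0 \<alpha> = total \<alpha>"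
  unfolding boxes_from_def total_def using is_partition_nonneg[OF assms] by (intro sum.cong) auto

definition interval_lower :: "int_seq \<Rightarrow> int_seq \<Rightarrow> nat \<Rightarrow> int" where
  "interval_lower \<alpha> \<beta> i = max (Poly_Mapping.lookup \<beta> (Suc i)) (Poly_Mapping.lookup \<alpha> i)"

definition interval_upper :: "int_seq \<Rightarrow> int_seq \<Rightarrow> nat \<Rightarrow> int" where
  "interval_upper \<alpha> \<beta> i = (case i of 0 \<Rightarrow> Poly_Mapping.lookup \<beta> 0
     | Suc j \<Rightarrow> min (Poly_Mapping.lookup \<beta> i) (Poly_Mapping.lookup \<alpha> j))"

text \<open>
  The partitions \<open>\<xi>\<close> between \<open>\<alpha>\<close> and \<open>\<beta>\<close> form a box: its rows move independently of each other.
\<close>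

lemma horizontal_strip_between_iff:
  "horizontal_strip \<alpha> \<xi> \<and> horizontal_strip \<xi> \<beta> \<longleftrightarrow>
    (\<forall>i. interval_lower \<alpha> \<beta> i \<le> Poly_Mapping.lookup \<xi> i \<and> Poly_Mapping.lookup \<xi> i \<le> interval_upper \<alpha> \<beta> i)"
  (is "?l \<longleftrightarrow> ?r")
proof
  assume ?l thus ?r by (auto simp: horizontal_strip_def interval_lower_def interval_upper_def split: nat.split)
next
  assume r: ?r
  have "Poly_Mapping.lookup \<xi> (Suc i) \<le> Poly_Mapping.lookup \<alpha> i" for i
    using r[rule_format, of "Suc i"] by (simp add: interval_upper_def)
  moreover have "Poly_Mapping.lookup \<xi> i \<le> Poly_Mapping.lookup \<beta> i" for i
    using r[rule_format, of i] by (cases i) (simp_all add: interval_upper_def)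
  ultimately show ?l using r by (simp add: horizontal_strip_def interval_lower_def)
qed

text \<open>
  The row \<open>\<xi>\<^sub>i\<close> may move freely in an interval determined by \<open>\<alpha>\<close> and \<open>\<beta>\<close>. Reflecting it there is
  the Bender-Knuth involution; here only the part of the picture left of column \<open>r\<close> is reflected, which is
  why every term is cut off at \<open>r\<close>.
\<close>

definition toggle :: "nat \<Rightarrow> int_seq \<Rightarrow> int_seq \<Rightarrow> int_seq \<Rightarrow> int_seq" where
  "toggle r \<alpha> \<beta> \<xi> = Abs_poly_mapping (\<lambda>i. Poly_Mapping.lookup \<xi> i
     + min (interval_upper \<alpha> \<beta> i) (int r) + min (interval_lower \<alpha> \<beta> i) (int r)
     - 2 * min (Poly_Mapping.lookup \<xi> i) (int r))"

lemma lookup_toggle: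
  assumes "horizontal_strip \<alpha> \<xi>" "horizontal_strip \<xi> \<beta>"
  shows "Poly_Mapping.lookup (toggle r \<alpha> \<beta> \<xi>) i = Poly_Mapping.lookup \<xi> i
     + min (interval_upper \<alpha> \<beta> i) (int r) + min (interval_lower \<alpha> \<beta> i) (int r)
     - 2 * min (Poly_Mapping.lookup \<xi> i) (int r)"
proof -
  let ?f = "\<lambda>i. Poly_Mapping.lookup \<xi> i
     + min (interval_upper \<alpha> \<beta> i) (int r) + min (interval_lower \<alpha> \<beta> i) (int r)
     - 2 * min (Poly_Mapping.lookup \<xi> i) (int r)"
  obtain n where n: "Poly_Mapping.keys \<beta> \<subseteq> {..<n}" by (rule keys_bounded)
  have zero: "?f i = 0" if "n \<le> i" for i
  proof -
    have "Poly_Mapping.lookup \<beta> i = 0" "Poly_Mapping.lookup \<beta> (Suc i) = 0"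
      using lookup_beyond[OF n] that by auto
    moreover have nonneg: "0 \<le> Poly_Mapping.lookup \<alpha> j" for j
      using horizontal_strip_partition[OF assms(1)] is_partition_nonneg by blast
    moreover have "Poly_Mapping.lookup \<alpha> i \<le> Poly_Mapping.lookup \<xi> i" "Poly_Mapping.lookup \<xi> i \<le> Poly_Mapping.lookup \<beta> i"
      using assms by (auto simp: horizontal_strip_def)
    ultimately have "Poly_Mapping.lookup \<xi> i = 0" "Poly_Mapping.lookup \<alpha> i = 0"
      using nonneg[of i] by linarith+
    moreover from this have "interval_lower \<alpha> \<beta> i = 0" "interval_upper \<alpha> \<beta> i = 0"
      using \<open>Poly_Mapping.lookup \<beta> i = 0\<close> \<open>Poly_Mapping.lookup \<beta> (Suc i) = 0\<close> nonneg by (auto simp: interval_lower_def interval_upper_def min_def split: nat.split)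
    ultimately show ?thesis by simp
  qed
  have "{i. ?f i \<noteq> 0} \<subseteq> {..<n}"
  proof
    fix i assume "i \<in> {i. ?f i \<noteq> 0}"
    hence "\<not> n \<le> i" using zero by blast
    thus "i \<in> {..<n}" by simp
  qed
  hence "finite {i. ?f i \<noteq> 0}" by (rule finite_subset) simp
  thus ?thesis by (simp add: toggle_def lookup_Abs_poly_mapping)
qed

text \<open>
  One row of the toggle. By the third assumption a row that meets column \<open>r\<close> has all its movable boxes strictly
  to the right of \<open>r\<close>, so that it stays fixed; the other rows end before column \<open>r\<close> and are reflected.
\<close>

lemma toggle_row:
  fixes x y lo hi r :: int
  assumes "lo \<le> x" "x \<le> hi" "r < x \<Longrightarrow> r < lo" and y: "y = x + min hi r + min lo r - 2 * min x r"
  shows "lo \<le> y" "y \<le> hi" "min y r = min hi r + min lo r - min x r" "r \<le> s \<Longrightarrow> max (y - s) 0 = max (x - s) 0"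
  using assms by (auto simp: min_def max_def split: if_splits)

text \<open>
  The upper end in row \<open>i + 1\<close> and the lower end in row \<open>i\<close> are the minimum and the maximum of
  \<open>\<beta>\<^sub>i\<^sub>+\<^sub>1\<close> and \<open>\<alpha>\<^sub>i\<close>, so together they contribute the sum of these two numbers.
\<close>

lemma sum_interval_ends:
  "(\<Sum>i<Suc n. min (interval_upper \<alpha> \<beta> i) r + min (interval_lower \<alpha> \<beta> i) r) =
    (\<Sum>i<Suc n. min (Poly_Mapping.lookup \<beta> i) r) + (\<Sum>i<n. min (Poly_Mapping.lookup \<alpha> i) r)
      + min (interval_lower \<alpha> \<beta> n) r"
proof (induction n)
  case (Suc n)
  have "min (interval_upper \<alpha> \<beta> (Suc n)) r + min (interval_lower \<alpha> \<beta> n) r =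
      min (Poly_Mapping.lookup \<beta> (Suc n)) r + min (Poly_Mapping.lookup \<alpha> n) r"
    by (simp add: interval_upper_def interval_lower_def min_def max_def)
  thus ?case using Suc by simp
qed (simp add: interval_upper_def)

text \<open>
  Three consecutive members of a chain: the boxes of \<open>\<xi>/\<alpha>\<close> carry one entry and those of \<open>\<beta>/\<xi>\<close> the
  next one. The lattice condition for these two entries fails at column \<open>r\<close> but holds at column \<open>r + 1\<close>.
\<close>

locale critical_column =
  fixes \<alpha> \<xi> \<beta> :: int_seq and r :: nat
  assumes lower: "horizontal_strip \<alpha> \<xi>" and upper: "horizontal_strip \<xi> \<beta>"
    and violated: "2 * boxes_from r \<xi> < boxes_from r \<alpha> + boxes_from r \<beta>"
    and last: "boxes_from (Suc r) \<alpha> + boxes_from (Suc r) \<beta> \<le> 2 * boxes_from (Suc r) \<xi>"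
begin

definition meets :: "int_seq \<Rightarrow> nat \<Rightarrow> int" where
  "meets \<gamma> i = (if int r < Poly_Mapping.lookup \<gamma> i then 1 else 0)"

lemma boxes_from_diff:
  assumes "Poly_Mapping.keys \<gamma> \<subseteq> {..<n}"
  shows "boxes_from r \<gamma> = boxes_from (Suc r) \<gamma> + (\<Sum>i<n. meets \<gamma> i)"
  unfolding boxes_from_eq_sum[OF assms] sum.distrib[symmetric] by (rule sum.cong) (auto simp: meets_def)

lemma le: "Poly_Mapping.lookup \<alpha> i \<le> Poly_Mapping.lookup \<xi> i" "Poly_Mapping.lookup \<xi> i \<le> Poly_Mapping.lookup \<beta> i"
  using lower upper by (simp_all add: horizontal_strip_def)

lemma partitions: "is_partition \<alpha>" "is_partition \<xi>" "is_partition \<beta>"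
  using horizontal_strip_partition lower upper by blast+

lemma keys_le:
  assumes "Poly_Mapping.keys \<beta> \<subseteq> {..<n}"
  shows "Poly_Mapping.keys \<xi> \<subseteq> {..<n}" "Poly_Mapping.keys \<alpha> \<subseteq> {..<n}"
  using keys_subset_of_le[of \<xi> \<beta>] keys_subset_of_le[of \<alpha> \<xi>] le is_partition_nonneg[OF partitions(1)]
    is_partition_nonneg[OF partitions(2)] assms by blast+

lemma sum_meets:
  assumes "Poly_Mapping.keys \<beta> \<subseteq> {..<n}"
  shows "2 * boxes_from r \<xi> - boxes_from r \<alpha> - boxes_from r \<beta> =
    (2 * boxes_from (Suc r) \<xi> - boxes_from (Suc r) \<alpha> - boxes_from (Suc r) \<beta>) + (\<Sum>i<n. 2 * meets \<xi> i - meets \<alpha> i - meets \<beta> i)"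
  using boxes_from_diff[OF assms] boxes_from_diff[OF keys_le(1)[OF assms]] boxes_from_diff[OF keys_le(2)[OF assms]]
  by (simp add: sum_subtractf sum_distrib_left)

text \<open>
  At most one row meets column \<open>r\<close> in \<open>\<beta>\<close> but not in \<open>\<xi>\<close>: row \<open>i + 1\<close> of \<open>\<beta>\<close> is no longer than row \<open>i\<close> of \<open>\<xi>\<close>.
\<close>

lemma sum_meets_upper:
  assumes "Poly_Mapping.keys \<beta> \<subseteq> {..<n}"
  shows "(\<Sum>i<n. meets \<beta> i) \<le> 1 + (\<Sum>i<n. meets \<xi> i)"
proof (cases n)
  case (Suc m)
  have "(\<Sum>i<m. meets \<beta> (Suc i)) \<le> (\<Sum>i<m. meets \<xi> i)"
  proof (rule sum_mono)
    fix i
    have "Poly_Mapping.lookup \<beta> (Suc i) \<le> Poly_Mapping.lookup \<xi> i" using upper by (simp add: horizontal_strip_def)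
    thus "meets \<beta> (Suc i) \<le> meets \<xi> i" by (simp add: meets_def)
  qed
  moreover have "meets \<beta> 0 \<le> 1" "0 \<le> meets \<xi> m" by (simp_all add: meets_def)
  ultimately have "meets \<beta> 0 + (\<Sum>i<m. meets \<beta> (Suc i)) \<le> 1 + (\<Sum>i<Suc m. meets \<xi> i)" by simp
  thus ?thesis unfolding Suc by (subst sum.lessThan_Suc_shift)
qed simp

text \<open>
  Passing from column \<open>r + 1\<close> to column \<open>r\<close> adds at most one box of \<open>\<beta>/\<xi>\<close>, so the lattice condition,
  which holds from \<open>r + 1\<close> on, fails at \<open>r\<close> by exactly one. This is the shift by one in the dot action.
\<close>

lemma violation_eq: "2 * boxes_from r \<xi> = boxes_from r \<alpha> + boxes_from r \<beta> - 1"
proof -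
  obtain n where n: "Poly_Mapping.keys \<beta> \<subseteq> {..<n}" by (rule keys_bounded)
  have "(\<Sum>i<n. meets \<alpha> i) \<le> (\<Sum>i<n. meets \<xi> i)"
    by (rule sum_mono) (use le(1) in \<open>auto simp: meets_def intro: less_le_trans\<close>)
  thus ?thesis
    using sum_meets[OF n] sum_meets_upper[OF n] violated last by (simp add: sum_subtractf sum_distrib_left[symmetric])
qed

text \<open>
  A box of \<open>\<xi>/\<alpha>\<close> in column \<open>r\<close> would compensate the only box of \<open>\<beta>/\<xi>\<close> that column \<open>r\<close>
  can contain, and the lattice condition could not fail at \<open>r\<close> while holding at \<open>r + 1\<close>.
\<close>

lemma column_free:
  assumes "int r < Poly_Mapping.lookup \<xi> i"
  shows "int r < Poly_Mapping.lookup \<alpha> i"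
proof (rule ccontr)
  assume not: "\<not> int r < Poly_Mapping.lookup \<alpha> i"
  obtain n where n: "Poly_Mapping.keys \<beta> \<subseteq> {..<n}" by (rule keys_bounded)
  have "i < n" using lookup_beyond[OF keys_le(1)[OF n], of i] assms by (metis not_le of_nat_0_le_iff)
  have "meets \<xi> i - meets \<alpha> i \<le> (\<Sum>i<n. meets \<xi> i - meets \<alpha> i)"
  proof (rule member_le_sum)
    show "0 \<le> meets \<xi> j - meets \<alpha> j" for j using le(1)[of j] by (simp add: meets_def)
  qed (use \<open>i < n\<close> in auto)
  hence "1 \<le> (\<Sum>i<n. meets \<xi> i) - (\<Sum>i<n. meets \<alpha> i)"
    using assms not by (simp add: meets_def[of _ i] sum_subtractf)
  thus False
    using sum_meets[OF n] sum_meets_upper[OF n] violated last by (simp add: sum_subtractf sum_distrib_left[symmetric])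
qed

abbreviation \<eta> :: int_seq where "\<eta> \<equiv> toggle r \<alpha> \<beta> \<xi>"

lemma toggle_facts:
  "interval_lower \<alpha> \<beta> i \<le> Poly_Mapping.lookup \<eta> i" "Poly_Mapping.lookup \<eta> i \<le> interval_upper \<alpha> \<beta> i"
  "min (Poly_Mapping.lookup \<eta> i) (int r) =
     min (interval_upper \<alpha> \<beta> i) (int r) + min (interval_lower \<alpha> \<beta> i) (int r) - min (Poly_Mapping.lookup \<xi> i) (int r)"
  "r \<le> s \<Longrightarrow> max (Poly_Mapping.lookup \<eta> i - int s) 0 = max (Poly_Mapping.lookup \<xi> i - int s) 0"
proof -
  have "interval_lower \<alpha> \<beta> i \<le> Poly_Mapping.lookup \<xi> i" "Poly_Mapping.lookup \<xi> i \<le> interval_upper \<alpha> \<beta> i"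
    using horizontal_strip_between_iff[of \<alpha> \<xi> \<beta>] lower upper by blast+
  moreover have "int r < interval_lower \<alpha> \<beta> i" if "int r < Poly_Mapping.lookup \<xi> i"
    using column_free[OF that] by (simp add: interval_lower_def)
  ultimately show
    "interval_lower \<alpha> \<beta> i \<le> Poly_Mapping.lookup \<eta> i" "Poly_Mapping.lookup \<eta> i \<le> interval_upper \<alpha> \<beta> i"
    "min (Poly_Mapping.lookup \<eta> i) (int r) =
       min (interval_upper \<alpha> \<beta> i) (int r) + min (interval_lower \<alpha> \<beta> i) (int r) - min (Poly_Mapping.lookup \<xi> i) (int r)"
    "r \<le> s \<Longrightarrow> max (Poly_Mapping.lookup \<eta> i - int s) 0 = max (Poly_Mapping.lookup \<xi> i - int s) 0"
    using toggle_row(1-3)[OF _ _ _ lookup_toggle[OF lower upper, of r i]]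
      toggle_row(4)[OF _ _ _ lookup_toggle[OF lower upper, of r i], of "int s"] by auto
qed

lemma horizontal_strip_toggle: "horizontal_strip \<alpha> \<eta>" "horizontal_strip \<eta> \<beta>"
  using horizontal_strip_between_iff[of \<alpha> \<eta> \<beta>] toggle_facts(1,2) by blast+

lemma keys_toggle: "Poly_Mapping.keys \<beta> \<subseteq> {..<n} \<Longrightarrow> Poly_Mapping.keys \<eta> \<subseteq> {..<n}"
  using keys_subset_of_le[of \<eta> \<beta>] horizontal_strip_toggle(2) horizontal_strip_partition[OF horizontal_strip_toggle(2)] is_partition_nonneg
  unfolding horizontal_strip_def by blast

lemma boxes_from_toggle:
  assumes "r \<le> s" shows "boxes_from s \<eta> = boxes_from s \<xi>"
proof -
  obtain n where n: "Poly_Mapping.keys \<beta> \<subseteq> {..<n}" by (rule keys_bounded)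
  show ?thesis
    unfolding boxes_from_eq_sum[OF keys_toggle[OF n]] boxes_from_eq_sum[OF keys_le(1)[OF n]]
    using toggle_facts(4)[OF assms] by simp
qed

lemma toggle_toggle: "toggle r \<alpha> \<beta> \<eta> = \<xi>"
  by (rule poly_mapping_eqI)
     (simp add: lookup_toggle[OF horizontal_strip_toggle] toggle_facts(3), simp add: lookup_toggle[OF lower upper])

lemma total_toggle: "total \<eta> = total \<alpha> + total \<beta> - total \<xi> - 1"
proof -
  obtain m where m: "Poly_Mapping.keys \<beta> \<subseteq> {..<m}" by (rule keys_bounded)
  hence n: "Poly_Mapping.keys \<beta> \<subseteq> {..<Suc m}" by (auto simp: less_Suc_eq)
  have split: "total \<gamma> = (\<Sum>i<k. min (Poly_Mapping.lookup \<gamma> i) (int r)) + boxes_from r \<gamma>"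
    if "Poly_Mapping.keys \<gamma> \<subseteq> {..<k}" for \<gamma> k
    unfolding total_eq_sum[OF that] boxes_from_eq_sum[OF that] sum.distrib[symmetric]
    by (rule sum.cong) (auto simp: min_def max_def)
  have "Poly_Mapping.lookup \<beta> (Suc m) = 0" "Poly_Mapping.lookup \<alpha> m = 0"
    using lookup_beyond[OF m] lookup_beyond[OF keys_le(2)[OF m]] by auto
  hence "min (interval_lower \<alpha> \<beta> m) (int r) = 0" by (simp add: interval_lower_def)
  hence "(\<Sum>i<Suc m. min (interval_upper \<alpha> \<beta> i) (int r) + min (interval_lower \<alpha> \<beta> i) (int r)) =
      (total \<beta> - boxes_from r \<beta>) + (total \<alpha> - boxes_from r \<alpha>)"
    using split[OF n] split[OF keys_le(2)[OF m]] unfolding sum_interval_ends by linarith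
  moreover have "total \<eta> - boxes_from r \<eta> =
      (\<Sum>i<Suc m. min (interval_upper \<alpha> \<beta> i) (int r) + min (interval_lower \<alpha> \<beta> i) (int r)) -
      (\<Sum>i<Suc m. min (Poly_Mapping.lookup \<xi> i) (int r))"
    unfolding split[OF keys_toggle[OF n]] sum_subtractf[symmetric]
    by (simp only: toggle_facts(3) add_diff_cancel_right')
  ultimately show ?thesis
    using split[OF keys_le(1)[OF n]] boxes_from_toggle[of r] violation_eq by simp
qed

end

text \<open>
  Semistandard tableaux recorded by the shapes formed by \<open>\<mu>\<close> and the entries \<open>\<le> k\<close>; \<open>\<beta>\<close> is the
  content. The chain stays constant from \<open>n\<close> on, which makes a chain determined by its first \<open>n + 1\<close> members.
\<close>

definition chains :: "nat \<Rightarrow> int_seq \<Rightarrow> int_seq \<Rightarrow> (nat \<Rightarrow> int_seq) set" where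
  "chains n \<mu> \<beta> = {p. p 0 = \<mu> \<and> (\<forall>k<n. horizontal_strip (p k) (p (Suc k)) \<and>
      total (p (Suc k)) = total (p k) + Poly_Mapping.lookup \<beta> k) \<and> (\<forall>k>n. p k = p n)}"

lemma chains_const: "p \<in> chains n \<mu> \<beta> \<Longrightarrow> n \<le> k \<Longrightarrow> p k = p n"
  unfolding chains_def by (cases "k = n") auto

lemma chains_partition:
  assumes "is_partition \<mu>" "p \<in> chains n \<mu> \<beta>"
  shows "is_partition (p k)"
proof -
  have "is_partition (p k)" if "k \<le> n" for k
  proof (cases k)
    case (Suc j)
    hence "horizontal_strip (p j) (p k)" using assms that by (simp add: chains_def)
    thus ?thesis by (rule horizontal_strip_partition)
  qed (use assms in \<open>simp add: chains_def\<close>)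
  moreover have "p k = p n" if "n \<le> k" using chains_const[OF assms(2) that] .
  ultimately show ?thesis by (metis nat_le_linear order_refl)
qed

lemma chains_horizontal_strip:
  assumes "is_partition \<mu>" "p \<in> chains n \<mu> \<beta>"
  shows "horizontal_strip (p k) (p (Suc k))"
proof (cases "k < n")
  case True thus ?thesis using assms by (simp add: chains_def)
next
  case False
  hence "p (Suc k) = p k" using chains_const[OF assms(2)] by (metis le_SucI not_less)
  thus ?thesis using horizontal_strip_refl[OF chains_partition[OF assms]] by simp
qed

theorem iterated_pieri:
  assumes \<mu>: "is_partition \<mu>"
  shows "(\<Prod>k<n. u (Poly_Mapping.lookup \<beta> k)) * schur_poly \<mu> = (\<Sum>p\<in>chains n \<mu> \<beta>. schur_poly (p n))
    \<and> finite (chains n \<mu> \<beta>)"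
proof (induction n)
  case 0
  have "p = (\<lambda>_. \<mu>)" if "p \<in> chains 0 \<mu> \<beta>" for p
    using chains_const[OF that] that by (auto simp: chains_def fun_eq_iff)
  hence "chains 0 \<mu> \<beta> = {\<lambda>_. \<mu>}" by (auto simp: chains_def)
  thus ?case by simp
next
  case (Suc n)
  let ?A = "\<lambda>p. {\<rho>. horizontal_strip (p n) \<rho> \<and> total \<rho> = total (p n) + Poly_Mapping.lookup \<beta> n}"
  let ?ext = "\<lambda>(p, \<rho>) k. if k \<le> n then p k else \<rho>"
  let ?res = "\<lambda>p'. (\<lambda>k. if k \<le> n then p' k else p' n, p' (Suc n))"
  have part: "is_partition (p n)" if "p \<in> chains n \<mu> \<beta>" for p
    using chains_partition[OF \<mu> that] .
  have res: "?res p' \<in> (SIGMA p:chains n \<mu> \<beta>. ?A p)" "?ext (?res p') = p'" if "p' \<in> chains (Suc n) \<mu> \<beta>" for p'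
  proof -
    show "?res p' \<in> (SIGMA p:chains n \<mu> \<beta>. ?A p)" using that by (auto simp: chains_def)
    have "p' (Suc n) = p' k" if "\<not> k \<le> n" for k
      using chains_const[OF \<open>p' \<in> _\<close>, of k] that by (metis not_less_eq_eq)
    thus "?ext (?res p') = p'" by (auto simp: fun_eq_iff)
  qed
  have ext: "?ext q \<in> chains (Suc n) \<mu> \<beta>" "?res (?ext q) = q" if "q \<in> (SIGMA p:chains n \<mu> \<beta>. ?A p)" for q
  proof -
    obtain p \<rho> where "q = (p, \<rho>)" by (cases q)
    with that have q: "q = (p, \<rho>)" "p \<in> chains n \<mu> \<beta>" "\<rho> \<in> ?A p" by simp_all
    show "?ext q \<in> chains (Suc n) \<mu> \<beta>" using q by (auto simp: chains_def less_Suc_eq)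
    have "p n = p k" if "\<not> k \<le> n" for k using chains_const[OF q(2), of k] that by simp
    thus "?res (?ext q) = q" using q(1) by (auto simp: fun_eq_iff)
  qed
  have fin: "finite (SIGMA p:chains n \<mu> \<beta>. ?A p)"
    using Suc pieri(2)[OF part] by (intro finite_SigmaI) auto
  have "(\<Prod>k<Suc n. u (Poly_Mapping.lookup \<beta> k)) * schur_poly \<mu> =
      u (Poly_Mapping.lookup \<beta> n) * (\<Sum>p\<in>chains n \<mu> \<beta>. schur_poly (p n))"
    using Suc by (simp add: mult_ac)
  also have "\<dots> = (\<Sum>p\<in>chains n \<mu> \<beta>. \<Sum>\<rho>\<in>?A p. schur_poly \<rho>)"
    unfolding sum_distrib_left using pieri(1)[OF part] by (intro sum.cong) auto
  also have "\<dots> = (\<Sum>(p, \<rho>)\<in>(SIGMA p:chains n \<mu> \<beta>. ?A p). schur_poly \<rho>)"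
    using Suc pieri(2)[OF part] by (intro sum.Sigma) auto
  also have "\<dots> = (\<Sum>p\<in>chains (Suc n) \<mu> \<beta>. schur_poly (p (Suc n)))"
    by (rule sum.reindex_bij_witness[of _ ?res ?ext]) (use res ext in \<open>auto split: prod.splits\<close>)
  moreover have "finite (chains (Suc n) \<mu> \<beta>)"
  proof (rule finite_subset)
    show "chains (Suc n) \<mu> \<beta> \<subseteq> ?ext ` (SIGMA p:chains n \<mu> \<beta>. ?A p)"
      using res by (metis (no_types, lifting) imageI subsetI)
  qed (use fin in blast)
  ultimately show ?case by simp
qed

lemma u_seq_eq_prod:
  "Poly_Mapping.keys \<beta> \<subseteq> {..<n} \<Longrightarrow> u_seq \<beta> = (\<Prod>k<n. u (Poly_Mapping.lookup \<beta> k))"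
  unfolding u_seq_def by (intro prod.mono_neutral_left) (auto simp: in_keys_iff u_def)

text \<open>
  Chains whose content lies in the dot orbit of \<open>\<nu>\<close>, with the permutation that witnesses it.
\<close>

definition signed_chains :: "nat \<Rightarrow> int_seq \<Rightarrow> int_seq \<Rightarrow> int_seq \<Rightarrow> ((nat \<Rightarrow> nat) \<times> (nat \<Rightarrow> int_seq)) set" where
  "signed_chains n \<kappa> \<mu> \<nu> = (SIGMA \<sigma>:{\<sigma>. \<sigma> permutes {..<n}}. {p \<in> chains n \<mu> (dot_action n \<sigma> \<nu>). p n = \<kappa>})"

lemma finite_signed_chains: "is_partition \<mu> \<Longrightarrow> finite (signed_chains n \<kappa> \<mu> \<nu>)"
  unfolding signed_chains_def using iterated_pieri by (intro finite_SigmaI) (auto simp: finite_permutations)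

theorem structure_const_signed_chains:
  assumes \<mu>: "is_partition \<mu>" and n: "Poly_Mapping.keys \<nu> \<subseteq> {..<n}"
  shows "structure_const \<kappa> \<mu> \<nu> = (\<Sum>(\<sigma>, p)\<in>signed_chains n \<kappa> \<mu> \<nu>. sign \<sigma>)"
proof -
  let ?P = "{\<sigma>. \<sigma> permutes {..<n}}"
  let ?C = "\<lambda>\<sigma>. chains n \<mu> (dot_action n \<sigma> \<nu>)"
  have finP: "finite ?P" by (simp add: finite_permutations)
  have finC: "finite (?C \<sigma>)" for \<sigma> using iterated_pieri[OF \<mu>] by blast
  define c where "c = (\<Sum>\<sigma>\<in>?P. \<Sum>p\<in>?C \<sigma>. frag_cmul (sign \<sigma>) (frag_of (p n)))"
  have "schur_poly \<mu> * schur_poly \<nu> = (\<Sum>\<sigma>\<in>?P. of_int (sign \<sigma>) * (u_seq (dot_action n \<sigma> \<nu>) * schur_poly \<mu>))"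
    by (simp add: jacobi_trudi[OF n] sum_distrib_left mult_ac)
  also have "\<dots> = (\<Sum>\<sigma>\<in>?P. \<Sum>p\<in>?C \<sigma>. of_int (sign \<sigma>) * schur_poly (p n))"
    using iterated_pieri[OF \<mu>] n
    by (intro sum.cong refl) (simp add: u_seq_eq_prod[OF keys_dot_action] sum_distrib_left)
  also have "\<dots> = frag_extend schur_poly c"
  proof -
    have "frag_extend schur_poly c =
        (\<Sum>\<sigma>\<in>?P. \<Sum>p\<in>?C \<sigma>. frag_extend schur_poly (frag_cmul (sign \<sigma>) (frag_of (p n))))"
      unfolding c_def using finP finC by (simp add: frag_extend_sum o_def)
    also have "\<dots> = (\<Sum>\<sigma>\<in>?P. \<Sum>p\<in>?C \<sigma>. frag_cmul (sign \<sigma>) (schur_poly (p n)))"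
      by (simp only: frag_extend_cmul frag_extend_of)
    finally show ?thesis by (simp only: frag_cmul_conv_mult)
  qed
  finally have f: "frag_extend schur_poly c = schur_poly \<mu> * schur_poly \<nu>" by simp
  have lookup_c: "Poly_Mapping.lookup c \<rho> = (\<Sum>\<sigma>\<in>?P. \<Sum>p\<in>?C \<sigma>. if p n = \<rho> then sign \<sigma> else 0)" for \<rho>
    unfolding c_def lookup_sum by (intro sum.cong) auto
  have "Poly_Mapping.keys c \<subseteq> Collect is_partition"
  proof
    fix \<rho> assume "\<rho> \<in> Poly_Mapping.keys c"
    hence "(\<Sum>\<sigma>\<in>?P. \<Sum>p\<in>?C \<sigma>. if p n = \<rho> then sign \<sigma> else 0) \<noteq> 0"
      by (simp add: in_keys_iff lookup_c)
    then obtain \<sigma> where "(\<Sum>p\<in>?C \<sigma>. if p n = \<rho> then sign \<sigma> else 0) \<noteq> 0"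
      by (rule sum.not_neutral_contains_not_neutral)
    then obtain p where p: "p \<in> ?C \<sigma>" "(if p n = \<rho> then sign \<sigma> else 0) \<noteq> 0"
      by (rule sum.not_neutral_contains_not_neutral)
    hence "p n = \<rho>" by (metis (full_types))
    thus "\<rho> \<in> Collect is_partition" using chains_partition[OF \<mu> p(1), of n] by simp
  qed
  from schur_coeffs_eqI[OF this f] have "structure_const \<kappa> \<mu> \<nu> = Poly_Mapping.lookup c \<kappa>"
    by (simp add: structure_const_def)
  also have "\<dots> = (\<Sum>\<sigma>\<in>?P. \<Sum>p\<in>{p \<in> ?C \<sigma>. p n = \<kappa>}. sign \<sigma>)"
    unfolding lookup_c using finC by (simp add: sum.inter_filter del: sum_constant)
  also have "\<dots> = (\<Sum>(\<sigma>, p)\<in>signed_chains n \<kappa> \<mu> \<nu>. sign \<sigma>)"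
    unfolding signed_chains_def using finP finC by (intro sum.Sigma) auto
  finally show ?thesis .
qed

text \<open>
  The columns of the tableau from \<open>r\<close> on contain fewer entries \<open>k + 1\<close> than \<open>k + 2\<close>, i.e. positions \<open>k\<close>
  and \<open>k + 1\<close> of their content are in the wrong order.
\<close>

definition violated :: "(nat \<Rightarrow> int_seq) \<Rightarrow> nat \<Rightarrow> nat \<Rightarrow> bool" where
  "violated p k r \<longleftrightarrow> boxes_from r (p (Suc k)) - boxes_from r (p k) < boxes_from r (p (Suc (Suc k))) - boxes_from r (p (Suc k))"

definition violated_column :: "(nat \<Rightarrow> int_seq) \<Rightarrow> nat" where
  "violated_column p = (GREATEST r. \<exists>k. violated p k r)"

definition violated_level :: "(nat \<Rightarrow> int_seq) \<Rightarrow> nat" where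
  "violated_level p = (LEAST k. violated p k (violated_column p))"

definition toggle_chain :: "(nat \<Rightarrow> int_seq) \<Rightarrow> (nat \<Rightarrow> int_seq)" where
  "toggle_chain p = (let k = violated_level p in
     p(Suc k := toggle (violated_column p) (p k) (p (Suc (Suc k))) (p (Suc k))))"

lemma boxes_from_eq_0:
  assumes "is_partition \<alpha>" "Poly_Mapping.lookup \<alpha> 0 \<le> int r"
  shows "boxes_from r \<alpha> = 0"
  unfolding boxes_from_def
proof (intro sum.neutral ballI)
  fix i
  have "Poly_Mapping.lookup \<alpha> i \<le> Poly_Mapping.lookup \<alpha> 0" by (rule is_partition_antimono[OF assms(1)]) simp
  thus "max (Poly_Mapping.lookup \<alpha> i - int r) 0 = 0" using assms(2) by simp
qed

lemma boxes_from_mono: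
  assumes "horizontal_strip \<alpha> \<beta>" shows "boxes_from r \<alpha> \<le> boxes_from r \<beta>"
proof -
  obtain n where n: "Poly_Mapping.keys \<beta> \<subseteq> {..<n}" by (rule keys_bounded)
  have le: "Poly_Mapping.lookup \<alpha> i \<le> Poly_Mapping.lookup \<beta> i" for i using assms by (simp add: horizontal_strip_def)
  have "Poly_Mapping.keys \<alpha> \<subseteq> Poly_Mapping.keys \<beta>"
    using is_partition_nonneg[OF horizontal_strip_partition(1)[OF assms]] le by (rule keys_subset_of_le)
  hence n': "Poly_Mapping.keys \<alpha> \<subseteq> {..<n}" using n by blast
  show ?thesis unfolding boxes_from_eq_sum[OF n] boxes_from_eq_sum[OF n'] using le by (intro sum_mono max.mono) auto
qed

lemma chains_le_last:
  assumes "is_partition \<mu>" "p \<in> chains n \<mu> \<beta>"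
  shows "Poly_Mapping.lookup (p k) i \<le> Poly_Mapping.lookup (p n) i"
proof (cases "k \<le> n")
  case True
  show ?thesis
    by (rule lift_Suc_mono_le[of "\<lambda>k. Poly_Mapping.lookup (p k) i", OF _ True])
       (use chains_horizontal_strip[OF assms] in \<open>simp add: horizontal_strip_def\<close>)
next
  case False
  thus ?thesis using chains_const[OF assms(2), of k] by simp
qed

text \<open>
  The toggle changes nothing in the columns from \<open>r\<close> on, so column and level of the violation are found again
  in the new chain; this makes the map an involution.
\<close>

lemma sign_reversal:
  assumes \<mu>: "is_partition \<mu>" and z: "(\<sigma>, p) \<in> signed_chains n \<kappa> \<mu> \<nu>" and violated: "\<exists>k r. violated p k r"
  defines "k \<equiv> violated_level p" and "p' \<equiv> toggle_chain p"
  shows "(\<sigma> \<circ> transpose k (Suc k), p') \<in> signed_chains n \<kappa> \<mu> \<nu>" "\<exists>k r. violated p' k r"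
    "violated_level p' = k" "toggle_chain p' = p" "sign (\<sigma> \<circ> transpose k (Suc k)) = - sign \<sigma>"
proof -
  let ?\<beta> = "dot_action n \<sigma> \<nu>" and ?\<tau> = "transpose k (Suc k)"
  define r where "r = violated_column p"
  have \<sigma>: "\<sigma> permutes {..<n}" and p: "p \<in> chains n \<mu> ?\<beta>" and pn: "p n = \<kappa>"
    using z by (auto simp: signed_chains_def)
  note h = chains_horizontal_strip[OF \<mu> p]
  have const: "p j = p n" if "n \<le> j" for j using chains_const[OF p that] .
  have bound: "s \<le> nat (Poly_Mapping.lookup \<kappa> 0)" if "violated p j s" for j s
  proof (rule ccontr)
    assume "\<not> s \<le> nat (Poly_Mapping.lookup \<kappa> 0)"
    hence "boxes_from s (p i) = 0" for i
      using chains_le_last[OF \<mu> p, of i 0] pn by (intro boxes_from_eq_0 chains_partition[OF \<mu> p]) simp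
    thus False using that by (simp add: violated_def)
  qed
  have "\<exists>j. violated p j r"
    unfolding r_def violated_column_def
    by (rule GreatestI_ex_nat[of _ "nat (Poly_Mapping.lookup \<kappa> 0)"]) (use violated bound in blast)+
  hence violated_kr: "violated p k r" unfolding k_def violated_level_def r_def[symmetric] by (rule LeastI_ex)
  have max_r: "s \<le> r" if "violated p j s" for j s
    unfolding r_def violated_column_def
    by (rule Greatest_le_nat[of _ _ "nat (Poly_Mapping.lookup \<kappa> 0)"]) (use that bound in blast)+
  have kn: "Suc k < n"
  proof (rule ccontr)
    assume "\<not> Suc k < n"
    hence "p (Suc (Suc k)) = p (Suc k)" using const[of "Suc k"] const[of "Suc (Suc k)"] by simp
    thus False using violated_kr boxes_from_mono[OF h[of k], of r] by (simp add: violated_def)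
  qed
  have \<tau>: "?\<tau> permutes {..<n}" using kn by (rule transpose_permutes)
  interpret critical_column "p k" "p (Suc k)" "p (Suc (Suc k))" r
  proof
    show "2 * boxes_from r (p (Suc k)) < boxes_from r (p k) + boxes_from r (p (Suc (Suc k)))" using violated_kr by (simp add: violated_def)
    have "\<not> violated p k (Suc r)" using max_r[of k "Suc r"] by auto
    thus "boxes_from (Suc r) (p k) + boxes_from (Suc r) (p (Suc (Suc k))) \<le> 2 * boxes_from (Suc r) (p (Suc k))"
      by (simp add: violated_def)
  qed (use h in auto)
  have p': "p' = p(Suc k := \<eta>)" by (simp add: p'_def toggle_chain_def Let_def k_def r_def)
  have violated_iff: "violated p' j s \<longleftrightarrow> violated p j s" if "r \<le> s" for j s
  proof -
    have "boxes_from s (p' i) = boxes_from s (p i)" for i using boxes_from_toggle[OF that] by (simp add: p')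
    thus ?thesis by (simp add: violated_def)
  qed
  show "\<exists>k r. violated p' k r" using violated_kr violated_iff by blast
  have col: "violated_column p' = r"
    unfolding violated_column_def
  proof (rule Greatest_equality)
    show "\<exists>j. violated p' j r" using violated_kr violated_iff by blast
    show "s \<le> r" if "\<exists>j. violated p' j s" for s
    proof (rule ccontr)
      assume "\<not> s \<le> r"
      thus False using that violated_iff[of s] max_r[of _ s] by auto
    qed
  qed
  show lev: "violated_level p' = k"
    unfolding violated_level_def col by (simp add: violated_iff k_def violated_level_def r_def)
  show "toggle_chain p' = p"
    unfolding toggle_chain_def lev col Let_def by (simp add: p' toggle_toggle)
  show "sign (\<sigma> \<circ> ?\<tau>) = - sign \<sigma>" using \<sigma> by (rule sign_compose_transpose)
  have \<beta>': "Poly_Mapping.lookup (dot_action n (\<sigma> \<circ> ?\<tau>) \<nu>) j =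
      (if j = k then Poly_Mapping.lookup ?\<beta> (Suc k) - 1
       else if j = Suc k then Poly_Mapping.lookup ?\<beta> k + 1 else Poly_Mapping.lookup ?\<beta> j)" for j
    unfolding dot_action_compose[OF \<sigma> \<tau>, symmetric] lookup_dot_action[OF \<tau>] by (auto simp: transpose_def)
  have tot: "total (p (Suc j)) = total (p j) + Poly_Mapping.lookup ?\<beta> j" if "j < n" for j
    using p that by (auto simp: chains_def)
  have "horizontal_strip (p' j) (p' (Suc j))" for j
    using h[of j] horizontal_strip_toggle by (auto simp: p')
  moreover have "total (p' (Suc j)) = total (p' j) + Poly_Mapping.lookup (dot_action n (\<sigma> \<circ> ?\<tau>) \<nu>) j" if "j < n" for j
    using tot[OF that] tot[OF kn] tot[of k] kn total_toggle by (auto simp: p' \<beta>')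
  moreover have "p' 0 = \<mu>" using p by (simp add: p' chains_def)
  moreover have "p' j = p' n" if "n < j" for j using const[of j] that kn by (simp add: p')
  ultimately have "p' \<in> chains n \<mu> (dot_action n (\<sigma> \<circ> ?\<tau>) \<nu>)" by (simp add: chains_def)
  moreover have "p' n = \<kappa>" using pn kn by (simp add: p')
  ultimately show "(\<sigma> \<circ> ?\<tau>, p') \<in> signed_chains n \<kappa> \<mu> \<nu>"
    using permutes_compose[OF \<tau> \<sigma>] by (simp add: signed_chains_def)
qed

lemma permutes_increasing_eq_id:
  fixes \<sigma> :: "nat \<Rightarrow> nat"
  assumes \<sigma>: "\<sigma> permutes S" and "\<And>i. \<sigma> i < \<sigma> (Suc i)"
  shows "\<sigma> = id"
proof
  fix i
  have mono: "strict_mono \<sigma>" using assms(2) by (simp add: strict_mono_Suc_iff)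
  have "strict_mono (Hilbert_Choice.inv \<sigma>)"
  proof (rule strict_monoI, rule ccontr)
    fix x y assume "x < y" "\<not> Hilbert_Choice.inv \<sigma> x < Hilbert_Choice.inv \<sigma> y"
    hence "\<sigma> (Hilbert_Choice.inv \<sigma> y) \<le> \<sigma> (Hilbert_Choice.inv \<sigma> x)"
      using mono by (simp add: strict_mono_less_eq)
    thus False using \<open>x < y\<close> by (simp add: permutes_inverses[OF \<sigma>])
  qed
  hence "\<sigma> i \<le> Hilbert_Choice.inv \<sigma> (\<sigma> i)" by (rule strict_mono_imp_increasing)
  thus "\<sigma> i = id i"
    using strict_mono_imp_increasing[OF mono, of i] by (simp add: permutes_inverses[OF \<sigma>])
qed

text \<open>
  Both \<open>\<nu>\<^sub>i - i\<close> and its rearrangement by \<open>\<sigma>\<close> are strictly decreasing, so \<open>\<sigma>\<close> is increasing.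
\<close>

lemma dot_action_partition_eq_id:
  assumes \<sigma>: "\<sigma> permutes {..<n}" and \<nu>: "is_partition \<nu>" and "is_partition (dot_action n \<sigma> \<nu>)"
  shows "\<sigma> = id"
proof (rule permutes_increasing_eq_id[OF \<sigma>])
  fix i
  have "Poly_Mapping.lookup \<nu> (\<sigma> (Suc i)) - int (\<sigma> (Suc i)) < Poly_Mapping.lookup \<nu> (\<sigma> i) - int (\<sigma> i)"
    using assms(3) unfolding is_partition_def lookup_dot_action[OF \<sigma>] by (smt (verit) of_nat_Suc)
  moreover have "Poly_Mapping.lookup \<nu> (\<sigma> i) \<le> Poly_Mapping.lookup \<nu> (\<sigma> (Suc i))" if "\<sigma> (Suc i) \<le> \<sigma> i"
    using is_partition_antimono[OF \<nu> that] .
  ultimately show "\<sigma> i < \<sigma> (Suc i)" by (smt (verit) not_le of_nat_mono)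
qed

definition lattice_chains :: "nat \<Rightarrow> int_seq \<Rightarrow> int_seq \<Rightarrow> int_seq \<Rightarrow> (nat \<Rightarrow> int_seq) set" where
  "lattice_chains n \<kappa> \<mu> \<nu> = {p \<in> chains n \<mu> \<nu>. p n = \<kappa> \<and> (\<forall>k r. \<not> violated p k r)}"

lemma lattice_content_partition:
  assumes \<mu>: "is_partition \<mu>" and p: "p \<in> chains n \<mu> \<beta>" and \<beta>: "Poly_Mapping.keys \<beta> \<subseteq> {..<n}"
    and good: "\<And>k. \<not> violated p k 0"
  shows "is_partition \<beta>"
proof (rule is_partitionI)
  fix k
  have content: "Poly_Mapping.lookup \<beta> k = boxes_from 0 (p (Suc k)) - boxes_from 0 (p k)" for k
  proof (cases "k < n")
    case True
    thus ?thesis using p chains_partition[OF \<mu> p] by (simp add: boxes_from_0 chains_def)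
  next
    case False
    hence "p k = p n" "p (Suc k) = p n" using chains_const[OF p, of k] chains_const[OF p, of "Suc k"] by auto
    thus ?thesis using False lookup_beyond[OF \<beta>] by simp
  qed
  show "Poly_Mapping.lookup \<beta> (Suc k) \<le> Poly_Mapping.lookup \<beta> k"
    using good[of k] by (simp add: content violated_def)
qed

lemma dot_action_id: "dot_action n id \<nu> = \<nu>"
  by (rule poly_mapping_eqI) (simp add: lookup_dot_action[OF permutes_id])

theorem structure_const_lattice_chains:
  assumes \<mu>: "is_partition \<mu>" and \<nu>: "is_partition \<nu>" and n: "Poly_Mapping.keys \<nu> \<subseteq> {..<n}"
  shows "structure_const \<kappa> \<mu> \<nu> = int (card (lattice_chains n \<kappa> \<mu> \<nu>))"
proof -
  let ?Z = "signed_chains n \<kappa> \<mu> \<nu>"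
  let ?B = "{(\<sigma>, p) \<in> ?Z. \<exists>k r. violated p k r}"
  let ?h = "\<lambda>(\<sigma>, p). (\<sigma> \<circ> transpose (violated_level p) (Suc (violated_level p)), toggle_chain p)"
  have "(\<Sum>(\<sigma>, p)\<in>?B. sign \<sigma>) = 0"
  proof (rule sum_eq_0_of_sign_reversing[of _ ?h])
    fix z assume "z \<in> ?B"
    then obtain \<sigma> p where z: "z = (\<sigma>, p)" "(\<sigma>, p) \<in> ?Z" "\<exists>k r. violated p k r" by auto
    note * = sign_reversal[OF \<mu> z(2,3)]
    show "?h z \<in> ?B" using *(1,2) by (simp add: z(1))
    show "?h (?h z) = z" using *(3,4) by (simp add: z(1) comp_assoc transpose_comp_involutory)
    show "(case ?h z of (\<sigma>, p) \<Rightarrow> sign \<sigma>) = - (case z of (\<sigma>, p) \<Rightarrow> sign \<sigma>)" using *(5) by (simp add: z(1))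
  qed
  moreover have "?Z - ?B = {id} \<times> lattice_chains n \<kappa> \<mu> \<nu>"
  proof (intro equalityI subsetI)
    fix z assume "z \<in> ?Z - ?B"
    then obtain \<sigma> p where z': "z = (\<sigma>, p)" "(\<sigma>, p) \<in> ?Z" and good: "\<And>k r. \<not> violated p k r"
      by (cases z) blast
    hence z: "z = (\<sigma>, p)" "\<sigma> permutes {..<n}" "p \<in> chains n \<mu> (dot_action n \<sigma> \<nu>)" "p n = \<kappa>"
      by (auto simp: signed_chains_def)
    have "is_partition (dot_action n \<sigma> \<nu>)"
      using lattice_content_partition[OF \<mu> z(3) keys_dot_action[OF z(2) n]] good by blast
    hence "\<sigma> = id" by (rule dot_action_partition_eq_id[OF z(2) \<nu>])
    thus "z \<in> {id} \<times> lattice_chains n \<kappa> \<mu> \<nu>" using z good by (simp add: lattice_chains_def dot_action_id)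
  next
    fix z :: "(nat \<Rightarrow> nat) \<times> (nat \<Rightarrow> int_seq)" assume "z \<in> {id} \<times> lattice_chains n \<kappa> \<mu> \<nu>"
    thus "z \<in> ?Z - ?B" using permutes_id by (auto simp: lattice_chains_def signed_chains_def dot_action_id)
  qed
  moreover have "?B \<subseteq> ?Z" by blast
  ultimately have "(\<Sum>(\<sigma>, p)\<in>?Z. sign \<sigma>) = (\<Sum>(\<sigma>, p)\<in>{id :: nat \<Rightarrow> nat} \<times> lattice_chains n \<kappa> \<mu> \<nu>. sign \<sigma>)"
    using sum.subset_diff[OF \<open>?B \<subseteq> ?Z\<close> finite_signed_chains[OF \<mu>], of "\<lambda>(\<sigma>, p). sign \<sigma>"] by simp
  also have "\<dots> = (\<Sum>z\<in>{id :: nat \<Rightarrow> nat} \<times> lattice_chains n \<kappa> \<mu> \<nu>. 1)"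
    by (intro sum.cong) auto
  also have "\<dots> = int (card (lattice_chains n \<kappa> \<mu> \<nu>))" by (simp add: card_cartesian_product)
  finally show ?thesis using structure_const_signed_chains[OF \<mu> n] by simp
qed


section \<open>Tableaux as chains of horizontal strips\<close>

text \<open>
  The correspondence between tableaux and chains: the boxes with entries at most \<open>k\<close>, together with
  \<open>\<mu>\<close>, form the diagram of \<open>p k\<close>. Being a tableau is a condition on \<open>T\<close> and being a chain
  one on \<open>p\<close>; this relation is the setting in which the two are compared.
\<close>

definition fills :: "int_seq \<Rightarrow> int_seq \<Rightarrow> (nat \<times> nat \<Rightarrow> nat) \<Rightarrow> (nat \<Rightarrow> int_seq) \<Rightarrow> bool" where
  "fills \<kappa> \<mu> T p \<longleftrightarrow> T \<in> skew_diagram \<kappa> \<mu> \<rightarrow>\<^sub>E {1..} \<and>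
     (\<forall>k i. Poly_Mapping.lookup \<mu> i \<le> Poly_Mapping.lookup (p k) i \<and>
        Poly_Mapping.lookup (p k) i \<le> Poly_Mapping.lookup \<kappa> i) \<and>
     (\<forall>i j k. (i, j) \<in> skew_diagram \<kappa> \<mu> \<longrightarrow> (T (i, j) \<le> k \<longleftrightarrow> int j < Poly_Mapping.lookup (p k) i))"

lemma skew_diagram_iff:
  "(i, j) \<in> skew_diagram \<kappa> \<mu> \<longleftrightarrow> Poly_Mapping.lookup \<mu> i \<le> int j \<and> int j < Poly_Mapping.lookup \<kappa> i"
  by (auto simp: skew_diagram_def diagram_def)

lemma fills_unique_tableau:
  assumes "fills \<kappa> \<mu> T p" "fills \<kappa> \<mu> T' p"
  shows "T = T'"
proof
  fix b :: "nat \<times> nat"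
  obtain i j where b: "b = (i, j)" by (cases b)
  show "T b = T' b"
  proof (cases "b \<in> skew_diagram \<kappa> \<mu>")
    case True
    hence "T b \<le> k \<longleftrightarrow> T' b \<le> k" for k using assms unfolding fills_def b by blast
    thus ?thesis by (metis order_antisym order_refl)
  next
    case False
    thus ?thesis using assms unfolding fills_def by (metis PiE_arb)
  qed
qed

lemma eq_if_same_nat_below:
  fixes x y a :: int
  assumes "0 \<le> a" "a \<le> x" "a \<le> y" "x \<le> c" "y \<le> c"
    and "\<And>j. a \<le> int j \<Longrightarrow> int j < c \<Longrightarrow> int j < x \<longleftrightarrow> int j < y"
  shows "x = y"
proof -
  have *: "\<not> x < y" if "a \<le> x" "y \<le> c" "\<And>j. a \<le> int j \<Longrightarrow> int j < c \<Longrightarrow> int j < y \<Longrightarrow> int j < x" for x y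
    using that(3)[of "nat x"] that(1,2) assms(1) by auto
  show ?thesis using *[of x y] *[of y x] assms by force
qed

lemma fills_unique_chain:
  assumes "is_partition \<mu>" "fills \<kappa> \<mu> T p" "fills \<kappa> \<mu> T p'"
  shows "p = p'"
proof (intro ext poly_mapping_eqI)
  fix k i
  show "Poly_Mapping.lookup (p k) i = Poly_Mapping.lookup (p' k) i"
  proof (rule eq_if_same_nat_below)
    fix j assume "Poly_Mapping.lookup \<mu> i \<le> int j" "int j < Poly_Mapping.lookup \<kappa> i"
    hence "(i, j) \<in> skew_diagram \<kappa> \<mu>" by (simp add: skew_diagram_iff)
    thus "int j < Poly_Mapping.lookup (p k) i \<longleftrightarrow> int j < Poly_Mapping.lookup (p' k) i"
      using assms(2,3) unfolding fills_def by blast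
  qed (use assms is_partition_nonneg in \<open>auto simp: fills_def\<close>)
qed

lemma initial_segment_eq:
  fixes A :: "nat set"
  assumes "finite A" "\<And>j. j \<in> A \<Longrightarrow> a \<le> j" "\<And>j j'. j \<in> A \<Longrightarrow> a \<le> j' \<Longrightarrow> j' \<le> j \<Longrightarrow> j' \<in> A"
  shows "A = {a..<a + card A}"
proof (cases "A = {}")
  case False
  hence M: "Max A \<in> A" using assms(1) by (rule Max_in[rotated])
  have "A = {a..Max A}"
  proof
    show "A \<subseteq> {a..Max A}" using assms(1,2) by auto
    show "{a..Max A} \<subseteq> A" using assms(3)[OF M] by auto
  qed
  moreover from this have "card A = Suc (Max A) - a" by (metis card_atLeastAtMost)
  moreover have "a \<le> Max A" using assms(2)[OF M] .
  ultimately show ?thesis by (simp add: atLeastLessThanSuc_atLeastAtMost)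
qed simp

definition fill :: "int_seq \<Rightarrow> int_seq \<Rightarrow> (nat \<Rightarrow> int_seq) \<Rightarrow> (nat \<times> nat \<Rightarrow> nat)" where
  "fill \<kappa> \<mu> p = restrict (\<lambda>(i, j). LEAST k. int j < Poly_Mapping.lookup (p k) i) (skew_diagram \<kappa> \<mu>)"

definition sublevel :: "int_seq \<Rightarrow> int_seq \<Rightarrow> (nat \<times> nat \<Rightarrow> nat) \<Rightarrow> nat \<Rightarrow> int_seq" where
  "sublevel \<kappa> \<mu> T k = Abs_poly_mapping (\<lambda>i. Poly_Mapping.lookup \<mu> i + int (card {j. (i, j) \<in> skew_diagram \<kappa> \<mu> \<and> T (i, j) \<le> k}))"

lemma fills_fill:
  assumes "is_partition \<mu>" "p \<in> chains n \<mu> \<beta>" "p n = \<kappa>"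
  shows "fills \<kappa> \<mu> (fill \<kappa> \<mu> p) p"
proof -
  let ?l = "\<lambda>k i. Poly_Mapping.lookup (p k) i"
  have p0: "p 0 = \<mu>" using assms(2) by (simp add: chains_def)
  have mono: "?l k i \<le> ?l k' i" if "k \<le> k'" for k k' i
    by (rule lift_Suc_mono_le[of "\<lambda>k. ?l k i", OF _ that])
       (use chains_horizontal_strip[OF assms(1,2)] in \<open>simp add: horizontal_strip_def\<close>)
  have key: "(LEAST k. int j < ?l k i) \<le> k \<longleftrightarrow> int j < ?l k i" if "(i, j) \<in> skew_diagram \<kappa> \<mu>" for i j k
  proof
    have "int j < ?l n i" using that assms(3) by (simp add: skew_diagram_iff)
    hence "int j < ?l (LEAST k. int j < ?l k i) i" by (rule LeastI)
    thus "int j < ?l k i" if "(LEAST k. int j < ?l k i) \<le> k" using mono[OF that, of i] by simp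
  qed (rule Least_le)
  have pos: "1 \<le> (LEAST k. int j < ?l k i)" if "(i, j) \<in> skew_diagram \<kappa> \<mu>" for i j
    using key[OF that, of 0] that p0 by (simp add: skew_diagram_iff)
  have "?l 0 i \<le> ?l k i" "?l k i \<le> ?l n i" for k i
    using mono[of 0 k i] chains_le_last[OF assms(1,2), of k i] by simp_all
  thus ?thesis
    using key pos p0 assms(3) by (auto simp: fills_def fill_def)
qed

lemma fills_sublevel:
  assumes \<mu>: "is_partition \<mu>" and T: "T \<in> ssyt \<kappa> \<mu>"
  shows "fills \<kappa> \<mu> T (sublevel \<kappa> \<mu> T)"
proof -
  let ?A = "\<lambda>i k. {j. (i, j) \<in> skew_diagram \<kappa> \<mu> \<and> T (i, j) \<le> k}"
  let ?f = "\<lambda>k i. Poly_Mapping.lookup \<mu> i + int (card (?A i k))"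
  have le: "Poly_Mapping.lookup \<mu> i \<le> Poly_Mapping.lookup \<kappa> i" for i
    using T by (simp add: ssyt_def seq_le_def)
  have nonneg: "0 \<le> Poly_Mapping.lookup \<mu> i" for i using \<mu> by (rule is_partition_nonneg)
  have sub: "?A i k \<subseteq> {nat (Poly_Mapping.lookup \<mu> i)..<nat (Poly_Mapping.lookup \<kappa> i)}" for i k
    by (auto simp: skew_diagram_iff)
  have fin: "finite (?A i k)" for i k by (rule finite_subset[OF sub]) simp
  have A: "?A i k = {nat (Poly_Mapping.lookup \<mu> i)..<nat (Poly_Mapping.lookup \<mu> i) + card (?A i k)}" for i k
  proof (rule initial_segment_eq[OF fin])
    fix j j' assume j: "j \<in> ?A i k" "nat (Poly_Mapping.lookup \<mu> i) \<le> j'" "j' \<le> j"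
    hence "(i, j') \<in> skew_diagram \<kappa> \<mu>" by (auto simp: skew_diagram_iff)
    moreover from this j have "T (i, j') \<le> T (i, j)" using T by (cases "j' = j") (auto simp: ssyt_def)
    ultimately show "j' \<in> ?A i k" using j(1) by auto
  qed (auto simp: skew_diagram_iff)
  have "card (?A i k) \<le> nat (Poly_Mapping.lookup \<kappa> i) - nat (Poly_Mapping.lookup \<mu> i)" for i k
    using card_mono[OF _ sub, of i k] by simp
  hence le': "?f k i \<le> Poly_Mapping.lookup \<kappa> i" for i k
  proof -
    have "int (card (?A i k)) \<le> int (nat (Poly_Mapping.lookup \<kappa> i) - nat (Poly_Mapping.lookup \<mu> i))"
      using \<open>card (?A i k) \<le> _\<close> by (simp only: of_nat_le_iff)
    also have "\<dots> = Poly_Mapping.lookup \<kappa> i - Poly_Mapping.lookup \<mu> i"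
      using le[of i] nonneg[of i] by (simp add: of_nat_diff nat_mono)
    finally show ?thesis by simp
  qed
  have lookup: "Poly_Mapping.lookup (sublevel \<kappa> \<mu> T k) i = ?f k i" for k i
  proof -
    have "{i. ?f k i \<noteq> 0} \<subseteq> Poly_Mapping.keys \<kappa>"
    proof
      fix i assume "i \<in> {i. ?f k i \<noteq> 0}"
      thus "i \<in> Poly_Mapping.keys \<kappa>" using le'[of i k] nonneg[of i] by (auto simp: in_keys_iff)
    qed
    hence "finite {i. ?f k i \<noteq> 0}" by (rule finite_subset) simp
    thus ?thesis by (simp add: sublevel_def lookup_Abs_poly_mapping)
  qed
  have "T (i, j) \<le> k \<longleftrightarrow> int j < ?f k i" if "(i, j) \<in> skew_diagram \<kappa> \<mu>" for i j k
  proof -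
    have "T (i, j) \<le> k \<longleftrightarrow> j \<in> ?A i k" using that by simp
    also have "\<dots> \<longleftrightarrow> int j < ?f k i" by (subst A) (use that nonneg[of i] in \<open>auto simp: skew_diagram_iff\<close>)
    finally show ?thesis .
  qed
  thus ?thesis using T le' by (simp add: fills_def lookup ssyt_def)
qed

text \<open>
  Row \<open>i\<close> contains the entry \<open>k + 1\<close> exactly in the columns from \<open>p k i\<close> up to \<open>p (k + 1) i\<close>.
\<close>

lemma fills_content:
  assumes \<mu>: "is_partition \<mu>" and f: "fills \<kappa> \<mu> T p"
  shows "Poly_Mapping.lookup (content_on T {(i, j) \<in> skew_diagram \<kappa> \<mu>. r \<le> j}) k =
    boxes_from r (p (Suc k)) - boxes_from r (p k)"
proof -
  let ?B = "{(i, j) \<in> skew_diagram \<kappa> \<mu>. r \<le> j}"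
  let ?l = "\<lambda>k i. Poly_Mapping.lookup (p k) i"
  obtain m where m: "Poly_Mapping.keys \<kappa> \<subseteq> {..<m}" by (rule keys_bounded)
  have bounds: "0 \<le> Poly_Mapping.lookup \<mu> i" "Poly_Mapping.lookup \<mu> i \<le> ?l k i" "?l k i \<le> Poly_Mapping.lookup \<kappa> i" for i k
    using f is_partition_nonneg[OF \<mu>] by (auto simp: fills_def)
  have keys: "Poly_Mapping.keys (p k) \<subseteq> {..<m}" for k
    using keys_subset_of_le[of "p k" \<kappa>] bounds order_trans[OF bounds(1,2)] m by blast
  have iff: "T (i, j) \<le> k \<longleftrightarrow> int j < ?l k i" if "(i, j) \<in> skew_diagram \<kappa> \<mu>" for i j k
    using f that by (simp add: fills_def)
  have mono: "?l k i \<le> ?l (Suc k) i" for i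
  proof (rule ccontr)
    assume "\<not> ?l k i \<le> ?l (Suc k) i"
    moreover define j where "j = nat (?l (Suc k) i)"
    ultimately have "int j = ?l (Suc k) i" "int j < ?l k i"
      using order_trans[OF bounds(1,2), of "Suc k" i] by auto
    moreover from this have "(i, j) \<in> skew_diagram \<kappa> \<mu>"
      using bounds(2)[of i "Suc k"] bounds(3)[of k i] by (simp add: skew_diagram_iff)
    ultimately show False using iff[of i j k] iff[of i j "Suc k"] by simp
  qed
  have fin: "finite ?B" by (rule finite_subset[of _ "diagram \<kappa>"]) (auto simp: skew_diagram_def finite_diagram)
  have "{b \<in> ?B. T b = Suc k} = (SIGMA i:{..<m}. {max (nat (?l k i)) r..<max (nat (?l (Suc k) i)) r})"
  proof (intro equalityI subrelI)
    fix i j assume "(i, j) \<in> {b \<in> ?B. T b = Suc k}"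
    hence ij: "(i, j) \<in> skew_diagram \<kappa> \<mu>" "r \<le> j" "T (i, j) = Suc k" by auto
    have "i < m" using ij(1) lookup_beyond[OF m, of i] by (cases "i < m") (auto simp: skew_diagram_iff)
    thus "(i, j) \<in> (SIGMA i:{..<m}. {max (nat (?l k i)) r..<max (nat (?l (Suc k) i)) r})"
      using iff[OF ij(1), of k] iff[OF ij(1), of "Suc k"] ij(2,3) by auto
  next
    fix i j assume "(i, j) \<in> (SIGMA i:{..<m}. {max (nat (?l k i)) r..<max (nat (?l (Suc k) i)) r})"
    hence j: "?l k i \<le> int j" "int j < ?l (Suc k) i" "r \<le> j" by auto
    hence ij: "(i, j) \<in> skew_diagram \<kappa> \<mu>"
      using bounds(2)[of i k] bounds(3)[of "Suc k" i] by (simp add: skew_diagram_iff)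
    thus "(i, j) \<in> {b \<in> ?B. T b = Suc k}"
      using iff[OF ij, of k] iff[OF ij, of "Suc k"] j by auto
  qed
  hence "int (card {b \<in> ?B. T b = Suc k}) = (\<Sum>i<m. int (max (nat (?l (Suc k) i)) r - max (nat (?l k i)) r))"
    by simp
  also have "\<dots> = (\<Sum>i<m. max (?l (Suc k) i - int r) 0 - max (?l k i - int r) 0)"
  proof (rule sum.cong[OF refl])
    fix i
    show "int (max (nat (?l (Suc k) i)) r - max (nat (?l k i)) r) = max (?l (Suc k) i - int r) 0 - max (?l k i - int r) 0"
      using mono[of i] order_trans[OF bounds(1,2), of k i] by (auto simp: max_def)
  qed
  also have "\<dots> = boxes_from r (p (Suc k)) - boxes_from r (p k)"
    by (simp add: boxes_from_eq_sum[OF keys] sum_subtractf)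
  finally show ?thesis by (simp add: lookup_content_on[OF fin])
qed

text \<open>
  Strict increase down the columns corresponds to the horizontal strip condition: the box above an entry
  \<open>k + 1\<close> carries an entry at most \<open>k\<close>.
\<close>

lemma fills_lr_iff:
  assumes \<kappa>: "is_partition \<kappa>" and \<mu>: "is_partition \<mu>" and n: "Poly_Mapping.keys \<nu> \<subseteq> {..<n}"
    and f: "fills \<kappa> \<mu> T p"
  shows "T \<in> lr_tableaux \<kappa> \<mu> \<nu> \<longleftrightarrow> p \<in> lattice_chains n \<kappa> \<mu> \<nu>"
proof
  let ?l = "\<lambda>k i. Poly_Mapping.lookup (p k) i"
  let ?D = "skew_diagram \<kappa> \<mu>"
  have bounds: "Poly_Mapping.lookup \<mu> i \<le> ?l k i" "?l k i \<le> Poly_Mapping.lookup \<kappa> i" for i k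
    using f by (simp_all add: fills_def)
  have nonneg: "0 \<le> Poly_Mapping.lookup \<mu> i" for i using \<mu> by (rule is_partition_nonneg)
  have iff: "T (i, j) \<le> k \<longleftrightarrow> int j < ?l k i" if "(i, j) \<in> ?D" for i j k
    using f that by (simp add: fills_def)
  have content: "Poly_Mapping.lookup (content_on T {(i, j) \<in> ?D. r \<le> j}) k = boxes_from r (p (Suc k)) - boxes_from r (p k)" for r k
    using fills_content[OF \<mu> f] .
  have D0: "{(i, j) \<in> ?D. 0 \<le> j} = ?D" by auto
  have lattice: "(\<forall>r. is_partition (content_on T {(i, j) \<in> ?D. r \<le> j})) \<longleftrightarrow> (\<forall>k r. \<not> violated p k r)"
  proof -
    have "is_partition \<gamma> \<longleftrightarrow> (\<forall>k. Poly_Mapping.lookup \<gamma> (Suc k) \<le> Poly_Mapping.lookup \<gamma> k)" for \<gamma>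
      using is_partitionI by (auto simp: is_partition_def)
    hence "is_partition (content_on T {(i, j) \<in> ?D. r \<le> j}) \<longleftrightarrow> (\<forall>k. \<not> violated p k r)" for r
      by (simp only: content violated_def not_less)
    thus ?thesis by blast
  qed
  {
    assume T: "T \<in> lr_tableaux \<kappa> \<mu> \<nu>"
    hence ssyt: "T \<in> ssyt \<kappa> \<mu>" and c: "content_on T ?D = \<nu>" by (simp_all add: lr_tableaux_def)
    have pos: "1 \<le> T b" if "b \<in> ?D" for b using ssyt that by (auto simp: ssyt_def)
    have strict: "T (i, j) < T (i', j)" if "(i, j) \<in> ?D" "(i', j) \<in> ?D" "i < i'" for i i' j
      using ssyt that by (simp add: ssyt_def)
    have "p 0 = \<mu>"
    proof (rule poly_mapping_eqI)
      fix i show "?l 0 i = Poly_Mapping.lookup \<mu> i"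
      proof (rule eq_if_same_nat_below[of "Poly_Mapping.lookup \<mu> i" _ _ "Poly_Mapping.lookup \<kappa> i"])
        fix j assume "Poly_Mapping.lookup \<mu> i \<le> int j" "int j < Poly_Mapping.lookup \<kappa> i"
        hence "(i, j) \<in> ?D" by (simp add: skew_diagram_iff)
        thus "int j < ?l 0 i \<longleftrightarrow> int j < Poly_Mapping.lookup \<mu> i"
          using iff[of i j 0] pos[of "(i, j)"] by (simp add: skew_diagram_iff)
      qed (use bounds nonneg order_trans[OF bounds] in auto)
    qed
    moreover have "p k = \<kappa>" if "n \<le> k" for k
    proof (rule poly_mapping_eqI)
      fix i show "?l k i = Poly_Mapping.lookup \<kappa> i"
      proof (rule eq_if_same_nat_below[of "Poly_Mapping.lookup \<mu> i" _ _ "Poly_Mapping.lookup \<kappa> i"])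
        fix j assume ij: "Poly_Mapping.lookup \<mu> i \<le> int j" "int j < Poly_Mapping.lookup \<kappa> i"
        hence b: "(i, j) \<in> ?D" by (simp add: skew_diagram_iff)
        have fin: "finite ?D" by (simp add: skew_diagram_def finite_diagram)
        obtain t where t: "T (i, j) = Suc t" using pos[OF b] by (cases "T (i, j)") auto
        have "(i, j) \<in> {b \<in> ?D. T b = Suc t}" using b t by simp
        moreover have "finite {b \<in> ?D. T b = Suc t}" using fin by simp
        ultimately have "card {b \<in> ?D. T b = Suc t} \<noteq> 0" by (metis card_0_eq empty_iff)
        hence "t \<in> Poly_Mapping.keys \<nu>" using lookup_content_on[OF fin, of T t] c by (simp add: in_keys_iff)
        hence "T (i, j) \<le> k" using n t \<open>n \<le> k\<close> by auto
        thus "int j < ?l k i \<longleftrightarrow> int j < Poly_Mapping.lookup \<kappa> i" using iff[OF b, of k] ij by simp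
      qed (use bounds nonneg order_trans[OF bounds] in auto)
    qed
    moreover have "horizontal_strip (p k) (p (Suc k))" for k
      unfolding horizontal_strip_def
    proof (intro allI conjI)
      fix i
      show "?l (Suc k) (Suc i) \<le> ?l k i"
      proof (rule ccontr)
        assume "\<not> ?l (Suc k) (Suc i) \<le> ?l k i"
        moreover define j where "j = nat (?l k i)"
        ultimately have j: "int j = ?l k i" "int j < ?l (Suc k) (Suc i)"
          using bounds(1)[of i k] nonneg[of i] by auto
        have "Poly_Mapping.lookup \<mu> (Suc i) \<le> Poly_Mapping.lookup \<mu> i" "Poly_Mapping.lookup \<kappa> (Suc i) \<le> Poly_Mapping.lookup \<kappa> i"
          using \<mu> \<kappa> by (simp_all add: is_partition_def)
        hence b: "(i, j) \<in> ?D" "(Suc i, j) \<in> ?D"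
          using j bounds(1)[of i k] bounds(2)[of "Suc k" "Suc i"] by (simp_all add: skew_diagram_iff)
        have "T (Suc i, j) \<le> Suc k" using iff[OF b(2)] j by simp
        hence "T (i, j) \<le> k" using strict[OF b] by simp
        thus False using iff[OF b(1)] j by simp
      qed
      show "?l k i \<le> ?l (Suc k) i"
      proof (rule ccontr)
        assume "\<not> ?l k i \<le> ?l (Suc k) i"
        moreover define j where "j = nat (?l (Suc k) i)"
        ultimately have j: "int j = ?l (Suc k) i" "int j < ?l k i"
          using bounds(1)[of i "Suc k"] nonneg[of i] by auto
        hence b: "(i, j) \<in> ?D"
          using bounds(1)[of i "Suc k"] bounds(2)[of k i] by (simp add: skew_diagram_iff)
        thus False using iff[OF b, of k] iff[OF b, of "Suc k"] j by simp
      qed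
    qed
    moreover from this have "total (p (Suc k)) = total (p k) + Poly_Mapping.lookup \<nu> k" for k
      using content[of 0 k] c horizontal_strip_partition[of "p k" "p (Suc k)"] unfolding D0 by (simp add: boxes_from_0)
    moreover have "\<forall>k r. \<not> violated p k r" using T lattice by (simp add: lr_tableaux_def)
    ultimately show "p \<in> lattice_chains n \<kappa> \<mu> \<nu>" by (simp add: lattice_chains_def chains_def)
  }
  {
    assume "p \<in> lattice_chains n \<kappa> \<mu> \<nu>"
    hence p: "p \<in> chains n \<mu> \<nu>" and pn: "p n = \<kappa>" and good: "\<forall>k r. \<not> violated p k r"
      by (simp_all add: lattice_chains_def)
    note h = chains_horizontal_strip[OF \<mu> p]
    have "T (i, j) \<le> T (i, j')" if "(i, j) \<in> ?D" "(i, j') \<in> ?D" "j < j'" for i j j'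
      using iff[OF that(1), of "T (i, j')"] iff[OF that(2), of "T (i, j')"] that(3) by simp
    moreover have "T (i, j) < T (i', j)" if "(i, j) \<in> ?D" "(i', j) \<in> ?D" "i < i'" for i i' j
    proof -
      have "1 \<le> T (i', j)" using f that(2) by (auto simp: fills_def)
      then obtain t where t: "T (i', j) = Suc t" by (cases "T (i', j)") auto
      obtain i'' where i'': "i' = Suc i''" "i \<le> i''" using \<open>i < i'\<close> by (cases i') auto
      have "int j < ?l (Suc t) (Suc i'')" using iff[OF that(2), of "Suc t"] t i'' by simp
      also have "\<dots> \<le> ?l t i''" using h[of t] by (simp add: horizontal_strip_def)
      also have "\<dots> \<le> ?l t i" using chains_partition[OF \<mu> p] i''(2) by (rule is_partition_antimono)
      finally show ?thesis using iff[OF that(1), of t] t by simp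
    qed
    moreover have "seq_le \<mu> \<kappa>" unfolding seq_le_def using order_trans[OF bounds] by blast
    ultimately have "T \<in> ssyt \<kappa> \<mu>" using f by (simp add: ssyt_def fills_def)
    moreover have "content_on T ?D = \<nu>"
    proof (rule poly_mapping_eqI)
      fix k
      have "Poly_Mapping.lookup (content_on T ?D) k = total (p (Suc k)) - total (p k)"
        using content[of 0 k] unfolding D0 by (simp add: boxes_from_0 chains_partition[OF \<mu> p])
      also have "\<dots> = Poly_Mapping.lookup \<nu> k"
      proof (cases "k < n")
        case True thus ?thesis using p by (simp add: chains_def)
      next
        case False
        thus ?thesis using chains_const[OF p, of k] chains_const[OF p, of "Suc k"] lookup_beyond[OF n, of k] by simp
      qed
      finally show "Poly_Mapping.lookup (content_on T ?D) k = Poly_Mapping.lookup \<nu> k" .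
    qed
    ultimately show "T \<in> lr_tableaux \<kappa> \<mu> \<nu>" using lattice good by (simp add: lr_tableaux_def)
  }
qed

lemma card_lattice_chains:
  assumes \<kappa>: "is_partition \<kappa>" and \<mu>: "is_partition \<mu>" and n: "Poly_Mapping.keys \<nu> \<subseteq> {..<n}"
  shows "card (lattice_chains n \<kappa> \<mu> \<nu>) = card (lr_tableaux \<kappa> \<mu> \<nu>)"
proof (rule bij_betw_same_card, rule bij_betwI[of "fill \<kappa> \<mu>" _ _ "sublevel \<kappa> \<mu>"])
  have fill: "fills \<kappa> \<mu> (fill \<kappa> \<mu> p) p" if "p \<in> lattice_chains n \<kappa> \<mu> \<nu>" for p
    using that fills_fill[OF \<mu>, of p n \<nu> \<kappa>] by (simp add: lattice_chains_def)
  have sub: "fills \<kappa> \<mu> T (sublevel \<kappa> \<mu> T)" if "T \<in> lr_tableaux \<kappa> \<mu> \<nu>" for T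
    using that fills_sublevel[OF \<mu>] by (simp add: lr_tableaux_def)
  show 1: "fill \<kappa> \<mu> \<in> lattice_chains n \<kappa> \<mu> \<nu> \<rightarrow> lr_tableaux \<kappa> \<mu> \<nu>"
    using fills_lr_iff[OF \<kappa> \<mu> n fill] by blast
  show 2: "sublevel \<kappa> \<mu> \<in> lr_tableaux \<kappa> \<mu> \<nu> \<rightarrow> lattice_chains n \<kappa> \<mu> \<nu>"
    using fills_lr_iff[OF \<kappa> \<mu> n sub] by blast
  show "sublevel \<kappa> \<mu> (fill \<kappa> \<mu> p) = p" if "p \<in> lattice_chains n \<kappa> \<mu> \<nu>" for p
    using fills_unique_chain[OF \<mu> sub fill[OF that]] 1 that by blast
  show "fill \<kappa> \<mu> (sublevel \<kappa> \<mu> T) = T" if "T \<in> lr_tableaux \<kappa> \<mu> \<nu>" for T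
    using fills_unique_tableau[OF fill sub[OF that]] 2 that by blast
qed

theorem mainTheorem2:
  fixes \<kappa> \<mu> \<nu> :: int_seq
  assumes "is_partition \<kappa>" and "is_partition \<mu>" and "is_partition \<nu>"
  shows "structure_const \<kappa> \<mu> \<nu> = int (card (lr_tableaux \<kappa> \<mu> \<nu>))"
proof -
  obtain n where n: "Poly_Mapping.keys \<nu> \<subseteq> {..<n}" by (rule keys_bounded)
  show ?thesis
    using structure_const_lattice_chains[OF assms(2,3) n] card_lattice_chains[OF assms(1,2) n] by simp
qed

end
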